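(* Let $(G')^{(0)}\times\mathbf T\xrightarrow{\iota'}E'\xrightarrow{j'}G'$ be a twist over a locally compact Hausdorff groupoid $G'$ with open range and source maps. Let $E$ be a locally compact Hausdorff groupoid with open range and source maps that is equivalent to $E'$, and let $Z$ be an $(E,E')$-equivalence. Then $E$ admits a principal left $\mathbf T$-action so that $E$ is a twist over a groupoid $G$ with unit space $Z/E'$ (identified with $E^{(0)}$ via the homeomorphism induced by the moment map $r_Z$). Furthermore, with respect to this twist structure on $E$, $Z$ is an $(E,E')$-twist equivalence over $(G,G')$.
   Context: Groupoids are locally compact Hausdorff topological groupoids with open range and source maps $r,s$; $G^{(0)}$ is the unit space. $\mathbf T$ is the circle group. Actions: a left action of $G$ on a space $P$ consists of a continuous moment map $r_P:P\to G^{(0)}$ and a continuous map $(\gamma,p)\mapsto\gamma\cdot p$ from $G*P=\{(\gamma,p): s(\gamma)=r_P(p)\}$ to $P$ with $r_P(\gamma\cdot p)=r(\gamma)$, $r_P(p)\cdot p=p$ and $\gamma\cdot(\eta\cdot p)=(\gamma\eta)\cdot p$ for composable $\gamma,\eta$. The action is free if $\gamma\cdot p=p$ only when $\gamma=r_P(p)$. It is proper if the map $(\gamma,p)\mapsto(\gamma\cdot p,p)$ from $G*P$ to $P\times P$ is proper (preimages of compact sets are compact). Right actions are defined similarly, with moment map $s_P$. A $(G,H)$-equivalence is a locally compact Hausdorff space $Z$ such that: (E1) $Z$ is a free and proper left $G$-space; (E2) $Z$ is a free and proper right $H$-space; (E3) the two actions commute; (E4) the moment map $r_Z:Z\to G^{(0)}$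 is open and induces a homeomorphism $Z/H\to G^{(0)}$; (E5) the moment map $s_Z:Z\to H^{(0)}$ is open and induces a homeomorphism $G\backslash Z\to H^{(0)}$. $G$ and $H$ are equivalent if such a $Z$ exists. A twist $E$ over $G$ is a central groupoid extension $G^{(0)}\times\mathbf T\xrightarrow{\iota}E\xrightarrow{j}G$, where $E$ is a groupoid, $\iota$ and $j$ are continuous groupoid homomorphisms, $\iota$ is a homeomorphism onto its range, $j$ is an open surjection inducing a homeomorphism of $E^{(0)}$ with $G^{(0)}$ (used to identify them, so $\iota(u,1)=u$), the kernel of $j$ is the range of $\iota$, and $\iota(r(e),t)e=e\,\iota(s(e),t)$ for all $e\in E$, $t\in\mathbf T$. The associated left $\mathbf T$-action on $E$ is $t\cdot e=\iota(r(e),t)e$; saying that $E$ is a twist via a given $\mathbf T$-action on $E$ means that the given action is the associated one. A principal $\mathbf T$-action is a continuous free (and, $\mathbf T$ being compact, automatically proper) action. If $E$ acts on the left of $Z$, then $\mathbf T$ acts on the left of $Z$ by $t\cdot z=\iota(r_Z(z),t)\cdot z$; if $E'$ (with $\iota'$) acts on the right of $Z$, then $\mathbf T$ acts on the right by $z\cdot t=z\cdot\iota'(s_Z(z),t)$. An $(E,E')$-twist equivalence over $(G,G')$ is an $(E,E')$-equivalence $Z$ such that $t\cdot z=z\cdot t$ for all $t\in\mathbf T$, $z\in Z$. *)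

theory Defs
  imports "HOL-Analysis.Analysis"
begin

section \<open>Topological groupoids\<close>

text \<open>
  A groupoid is an arrows-only structure: units are themselves arrows.
  Only the values on the topological space of arrows (and, for the product, on composable pairs)
  matter.
\<close>

record 'g groupoid =
  arrows :: "'g topology"
  rng :: "'g \<Rightarrow> 'g"
  src :: "'g \<Rightarrow> 'g"
  mult :: "'g \<Rightarrow> 'g \<Rightarrow> 'g"
  ginv :: "'g \<Rightarrow> 'g"

definition arrow_set :: "'g groupoid \<Rightarrow> 'g set"
  where "arrow_set G = topspace (arrows G)"

definition units :: "'g groupoid \<Rightarrow> 'g set"
  where "units G = {u \<in> arrow_set G. rng G u = u \<and> src G u = u}"

definition unit_space :: "'g groupoid \<Rightarrow> 'g topology"
  where "unit_space G = subtopology (arrows G) (units G)"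

definition composable_space :: "'g groupoid \<Rightarrow> ('g \<times> 'g) topology"
  where "composable_space G =
    subtopology (prod_topology (arrows G) (arrows G)) {(x, y). src G x = rng G y}"

definition algebraic_groupoid :: "'g groupoid \<Rightarrow> bool"
  where "algebraic_groupoid G \<longleftrightarrow>
    (\<forall>x\<in>arrow_set G. rng G x \<in> units G \<and> src G x \<in> units G) \<and>
    (\<forall>x\<in>arrow_set G. \<forall>y\<in>arrow_set G. src G x = rng G y \<longrightarrow>
       mult G x y \<in> arrow_set G \<and> rng G (mult G x y) = rng G x \<and> src G (mult G x y) = src G y) \<and>
    (\<forall>x\<in>arrow_set G. \<forall>y\<in>arrow_set G. \<forall>z\<in>arrow_set G. src G x = rng G y \<and> src G y = rng G z \<longrightarrow>
       mult G (mult G x y) z = mult G x (mult G y z)) \<and>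
    (\<forall>x\<in>arrow_set G. mult G (rng G x) x = x \<and> mult G x (src G x) = x) \<and>
    (\<forall>x\<in>arrow_set G. ginv G x \<in> arrow_set G \<and>
       rng G (ginv G x) = src G x \<and> src G (ginv G x) = rng G x \<and>
       mult G x (ginv G x) = rng G x \<and> mult G (ginv G x) x = src G x)"

text \<open>
  Continuity of range and source is automatic, since
  \<open>rng G x = mult G x (ginv G x)\<close> and \<open>src G x = mult G (ginv G x) x\<close>.
\<close>

definition topological_groupoid :: "'g groupoid \<Rightarrow> bool"
  where "topological_groupoid G \<longleftrightarrow>
    algebraic_groupoid G \<and>
    continuous_map (composable_space G) (arrows G) (\<lambda>(x, y). mult G x y) \<and>
    continuous_map (arrows G) (arrows G) (ginv G)"

definition lch_space :: "'a topology \<Rightarrow> bool"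
  where "lch_space X \<longleftrightarrow> locally_compact_space X \<and> Hausdorff_space X"

definition lch_groupoid :: "'g groupoid \<Rightarrow> bool"
  where "lch_groupoid G \<longleftrightarrow>
    topological_groupoid G \<and> lch_space (arrows G) \<and>
    open_map (arrows G) (unit_space G) (rng G) \<and>
    open_map (arrows G) (unit_space G) (src G)"

definition groupoid_hom :: "'g groupoid \<Rightarrow> 'h groupoid \<Rightarrow> ('g \<Rightarrow> 'h) \<Rightarrow> bool"
  where "groupoid_hom G H \<phi> \<longleftrightarrow>
    (\<forall>x\<in>arrow_set G. \<phi> x \<in> arrow_set H) \<and>
    (\<forall>x\<in>arrow_set G. \<forall>y\<in>arrow_set G. src G x = rng G y \<longrightarrow>
       src H (\<phi> x) = rng H (\<phi> y) \<and> \<phi> (mult G x y) = mult H (\<phi> x) (\<phi> y))"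


section \<open>Actions and equivalences\<close>

definition left_fibre_product :: "'g groupoid \<Rightarrow> 'p topology \<Rightarrow> ('p \<Rightarrow> 'g) \<Rightarrow> ('g \<times> 'p) topology"
  where "left_fibre_product G P m =
    subtopology (prod_topology (arrows G) P) {(\<gamma>, p). src G \<gamma> = m p}"

definition right_fibre_product :: "'p topology \<Rightarrow> ('p \<Rightarrow> 'h) \<Rightarrow> 'h groupoid \<Rightarrow> ('p \<times> 'h) topology"
  where "right_fibre_product P m H =
    subtopology (prod_topology P (arrows H)) {(p, \<eta>). m p = rng H \<eta>}"

definition left_action ::
    "'g groupoid \<Rightarrow> 'p topology \<Rightarrow> ('p \<Rightarrow> 'g) \<Rightarrow> ('g \<Rightarrow> 'p \<Rightarrow> 'p) \<Rightarrow> bool"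
  where "left_action G P m act \<longleftrightarrow>
    continuous_map P (unit_space G) m \<and>
    continuous_map (left_fibre_product G P m) P (\<lambda>(\<gamma>, p). act \<gamma> p) \<and>
    (\<forall>\<gamma>\<in>arrow_set G. \<forall>p\<in>topspace P. src G \<gamma> = m p \<longrightarrow> m (act \<gamma> p) = rng G \<gamma>) \<and>
    (\<forall>p\<in>topspace P. act (m p) p = p) \<and>
    (\<forall>\<gamma>\<in>arrow_set G. \<forall>\<eta>\<in>arrow_set G. \<forall>p\<in>topspace P. src G \<gamma> = rng G \<eta> \<and> src G \<eta> = m p \<longrightarrow>
       act \<gamma> (act \<eta> p) = act (mult G \<gamma> \<eta>) p)"

definition right_action ::
    "'h groupoid \<Rightarrow> 'p topology \<Rightarrow> ('p \<Rightarrow> 'h) \<Rightarrow> ('p \<Rightarrow> 'h \<Rightarrow> 'p) \<Rightarrow> bool"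
  where "right_action H P m act \<longleftrightarrow>
    continuous_map P (unit_space H) m \<and>
    continuous_map (right_fibre_product P m H) P (\<lambda>(p, \<eta>). act p \<eta>) \<and>
    (\<forall>p\<in>topspace P. \<forall>\<eta>\<in>arrow_set H. m p = rng H \<eta> \<longrightarrow> m (act p \<eta>) = src H \<eta>) \<and>
    (\<forall>p\<in>topspace P. act p (m p) = p) \<and>
    (\<forall>p\<in>topspace P. \<forall>\<gamma>\<in>arrow_set H. \<forall>\<eta>\<in>arrow_set H. m p = rng H \<gamma> \<and> src H \<gamma> = rng H \<eta> \<longrightarrow>
       act (act p \<gamma>) \<eta> = act p (mult H \<gamma> \<eta>))"

definition left_free ::
    "'g groupoid \<Rightarrow> 'p topology \<Rightarrow> ('p \<Rightarrow> 'g) \<Rightarrow> ('g \<Rightarrow> 'p \<Rightarrow> 'p) \<Rightarrow> bool"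
  where "left_free G P m act \<longleftrightarrow>
    (\<forall>\<gamma>\<in>arrow_set G. \<forall>p\<in>topspace P. src G \<gamma> = m p \<and> act \<gamma> p = p \<longrightarrow> \<gamma> = m p)"

definition right_free ::
    "'h groupoid \<Rightarrow> 'p topology \<Rightarrow> ('p \<Rightarrow> 'h) \<Rightarrow> ('p \<Rightarrow> 'h \<Rightarrow> 'p) \<Rightarrow> bool"
  where "right_free H P m act \<longleftrightarrow>
    (\<forall>p\<in>topspace P. \<forall>\<eta>\<in>arrow_set H. m p = rng H \<eta> \<and> act p \<eta> = p \<longrightarrow> \<eta> = m p)"

text \<open>
  Properness in the sense that preimages of compact sets are compact; the library's
  \<open>proper_map\<close> (closed with compact fibres) is a different definition, which agrees with this one
  for continuous maps into locally compact Hausdorff spaces.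
\<close>

definition compact_preimages :: "'a topology \<Rightarrow> 'b topology \<Rightarrow> ('a \<Rightarrow> 'b) \<Rightarrow> bool"
  where "compact_preimages X Y f \<longleftrightarrow>
    (\<forall>K. compactin Y K \<longrightarrow> compactin X {x \<in> topspace X. f x \<in> K})"

definition left_proper ::
    "'g groupoid \<Rightarrow> 'p topology \<Rightarrow> ('p \<Rightarrow> 'g) \<Rightarrow> ('g \<Rightarrow> 'p \<Rightarrow> 'p) \<Rightarrow> bool"
  where "left_proper G P m act \<longleftrightarrow>
    compact_preimages (left_fibre_product G P m) (prod_topology P P) (\<lambda>(\<gamma>, p). (act \<gamma> p, p))"

definition right_proper ::
    "'h groupoid \<Rightarrow> 'p topology \<Rightarrow> ('p \<Rightarrow> 'h) \<Rightarrow> ('p \<Rightarrow> 'h \<Rightarrow> 'p) \<Rightarrow> bool"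
  where "right_proper H P m act \<longleftrightarrow>
    compact_preimages (right_fibre_product P m H) (prod_topology P P) (\<lambda>(p, \<eta>). (act p \<eta>, p))"

definition left_orbit ::
    "'g groupoid \<Rightarrow> ('p \<Rightarrow> 'g) \<Rightarrow> ('g \<Rightarrow> 'p \<Rightarrow> 'p) \<Rightarrow> 'p \<Rightarrow> 'p set"
  where "left_orbit G m act p = {act \<gamma> p | \<gamma>. \<gamma> \<in> arrow_set G \<and> src G \<gamma> = m p}"

definition right_orbit ::
    "'h groupoid \<Rightarrow> ('p \<Rightarrow> 'h) \<Rightarrow> ('p \<Rightarrow> 'h \<Rightarrow> 'p) \<Rightarrow> 'p \<Rightarrow> 'p set"
  where "right_orbit H m act p = {act p \<eta> | \<eta>. \<eta> \<in> arrow_set H \<and> m p = rng H \<eta>}"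

definition quotient_space :: "'a topology \<Rightarrow> ('a \<Rightarrow> 'b) \<Rightarrow> 'b topology"
  where "quotient_space X q =
    topology (\<lambda>U. U \<subseteq> q ` topspace X \<and> openin X {x \<in> topspace X. q x \<in> U})"

lemma openin_quotient_space:
  "openin (quotient_space X q) U \<longleftrightarrow>
     U \<subseteq> q ` topspace X \<and> openin X {x \<in> topspace X. q x \<in> U}"
proof -
  have "istopology (\<lambda>U. U \<subseteq> q ` topspace X \<and> openin X {x \<in> topspace X. q x \<in> U})"
    unfolding istopology_def
  proof (intro conjI allI impI)
    fix S T
    assume S: "S \<subseteq> q ` topspace X \<and> openin X {x \<in> topspace X. q x \<in> S}"
      and T: "T \<subseteq> q ` topspace X \<and> openin X {x \<in> topspace X. q x \<in> T}"
    show "S \<inter> T \<subseteq> q ` topspace X" using S by blast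
    have "{x \<in> topspace X. q x \<in> S \<inter> T} =
        {x \<in> topspace X. q x \<in> S} \<inter> {x \<in> topspace X. q x \<in> T}" by blast
    then show "openin X {x \<in> topspace X. q x \<in> S \<inter> T}" using S T by auto
  next
    fix \<K>
    assume K: "\<forall>U\<in>\<K>. U \<subseteq> q ` topspace X \<and> openin X {x \<in> topspace X. q x \<in> U}"
    show "\<Union>\<K> \<subseteq> q ` topspace X" using K by blast
    have "{x \<in> topspace X. q x \<in> \<Union>\<K>} = (\<Union>U\<in>\<K>. {x \<in> topspace X. q x \<in> U})" by blast
    then show "openin X {x \<in> topspace X. q x \<in> \<Union>\<K>}" using K by auto
  qed
  then show ?thesis by (simp add: quotient_space_def)
qed

lemma topspace_quotient_space: "topspace (quotient_space X q) = q ` topspace X"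
proof
  show "topspace (quotient_space X q) \<subseteq> q ` topspace X"
    using openin_quotient_space openin_topspace by metis
  have "{x \<in> topspace X. q x \<in> q ` topspace X} = topspace X" by blast
  then have "openin (quotient_space X q) (q ` topspace X)"
    by (simp add: openin_quotient_space)
  then show "q ` topspace X \<subseteq> topspace (quotient_space X q)" by (rule openin_subset)
qed

lemma quotient_map_quotient_space: "quotient_map X (quotient_space X q) q"
  unfolding quotient_map_def openin_quotient_space topspace_quotient_space by blast

text \<open>
  The map on the quotient \<open>quotient_space X q\<close> induced by \<open>f\<close> is well defined and is a
  homeomorphism onto \<open>Y\<close>.
\<close>

definition induces_homeomorphism :: "'a topology \<Rightarrow> ('a \<Rightarrow> 'b) \<Rightarrow> 'c topology \<Rightarrow> ('a \<Rightarrow> 'c) \<Rightarrow> bool"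
  where "induces_homeomorphism X q Y f \<longleftrightarrow>
    (\<exists>h. homeomorphic_map (quotient_space X q) Y h \<and> (\<forall>x\<in>topspace X. h (q x) = f x))"

record ('g, 'z, 'h) bispace =
  zspace :: "'z topology"
  lmoment :: "'z \<Rightarrow> 'g"
  rmoment :: "'z \<Rightarrow> 'h"
  lact :: "'g \<Rightarrow> 'z \<Rightarrow> 'z"
  ract :: "'z \<Rightarrow> 'h \<Rightarrow> 'z"

text \<open>
  Commuting of the two actions includes that each moment map is invariant under the other action;
  otherwise the two sides of the equation need not both be defined.
\<close>

definition commuting_actions :: "'g groupoid \<Rightarrow> 'h groupoid \<Rightarrow> ('g, 'z, 'h) bispace \<Rightarrow> bool"
  where "commuting_actions G H Z \<longleftrightarrow>
    (\<forall>\<gamma>\<in>arrow_set G. \<forall>z\<in>topspace (zspace Z). \<forall>\<eta>\<in>arrow_set H.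
       src G \<gamma> = lmoment Z z \<and> rmoment Z z = rng H \<eta> \<longrightarrow>
         rmoment Z (lact Z \<gamma> z) = rmoment Z z \<and>
         lmoment Z (ract Z z \<eta>) = lmoment Z z \<and>
         ract Z (lact Z \<gamma> z) \<eta> = lact Z \<gamma> (ract Z z \<eta>))"

definition left_orbit_map :: "'g groupoid \<Rightarrow> ('g, 'z, 'h) bispace \<Rightarrow> 'z \<Rightarrow> 'z set"
  where "left_orbit_map G Z = left_orbit G (lmoment Z) (lact Z)"

definition right_orbit_map :: "'h groupoid \<Rightarrow> ('g, 'z, 'h) bispace \<Rightarrow> 'z \<Rightarrow> 'z set"
  where "right_orbit_map H Z = right_orbit H (rmoment Z) (ract Z)"

definition groupoid_equivalence :: "'g groupoid \<Rightarrow> 'h groupoid \<Rightarrow> ('g, 'z, 'h) bispace \<Rightarrow> bool"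
  where "groupoid_equivalence G H Z \<longleftrightarrow>
    lch_space (zspace Z) \<and>
    left_action G (zspace Z) (lmoment Z) (lact Z) \<and>
    left_free G (zspace Z) (lmoment Z) (lact Z) \<and>
    left_proper G (zspace Z) (lmoment Z) (lact Z) \<and>
    right_action H (zspace Z) (rmoment Z) (ract Z) \<and>
    right_free H (zspace Z) (rmoment Z) (ract Z) \<and>
    right_proper H (zspace Z) (rmoment Z) (ract Z) \<and>
    commuting_actions G H Z \<and>
    open_map (zspace Z) (unit_space G) (lmoment Z) \<and>
    induces_homeomorphism (zspace Z) (right_orbit_map H Z) (unit_space G) (lmoment Z) \<and>
    open_map (zspace Z) (unit_space H) (rmoment Z) \<and>
    induces_homeomorphism (zspace Z) (left_orbit_map G Z) (unit_space H) (rmoment Z)"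


section \<open>Circle actions and twists\<close>

abbreviation circle :: "complex set"
  where "circle \<equiv> sphere 0 1"

text \<open>
  Properness of a principal action is not listed: it is automatic because the circle is compact.
\<close>

definition principal_circle_action :: "'a topology \<Rightarrow> (complex \<Rightarrow> 'a \<Rightarrow> 'a) \<Rightarrow> bool"
  where "principal_circle_action X a \<longleftrightarrow>
    continuous_map (prod_topology (top_of_set circle) X) X (\<lambda>(t, x). a t x) \<and>
    (\<forall>x\<in>topspace X. a 1 x = x) \<and>
    (\<forall>t\<in>circle. \<forall>s\<in>circle. \<forall>x\<in>topspace X. a t (a s x) = a (t * s) x) \<and>
    (\<forall>t\<in>circle. \<forall>x\<in>topspace X. a t x = x \<longrightarrow> t = 1)"

definition trivial_circle_bundle :: "'g groupoid \<Rightarrow> ('g \<times> complex) groupoid"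
  where "trivial_circle_bundle G =
    \<lparr>arrows = prod_topology (unit_space G) (top_of_set circle),
     rng = (\<lambda>(u, t). (u, 1)),
     src = (\<lambda>(u, t). (u, 1)),
     mult = (\<lambda>(u, t) (v, s). (u, t * s)),
     ginv = (\<lambda>(u, t). (u, inverse t))\<rparr>"

text \<open>
  The identification of the unit space of \<open>E\<close> with that of \<open>G\<close> is made through \<open>j\<close>, so that
  \<open>\<iota>(r(e), t)\<close> is rendered as \<open>\<iota> (j (rng E e), t)\<close>, and \<open>\<iota>(u, 1) = u\<close> says
  that \<open>\<iota> (j u, 1) = u\<close> for every unit \<open>u\<close> of \<open>E\<close>.
\<close>

definition twist :: "'g groupoid \<Rightarrow> 'e groupoid \<Rightarrow> ('g \<times> complex \<Rightarrow> 'e) \<Rightarrow> ('e \<Rightarrow> 'g) \<Rightarrow> bool"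
  where "twist G E \<iota> j \<longleftrightarrow>
    lch_groupoid G \<and> lch_groupoid E \<and>
    groupoid_hom (trivial_circle_bundle G) E \<iota> \<and>
    embedding_map (arrows (trivial_circle_bundle G)) (arrows E) \<iota> \<and>
    groupoid_hom E G j \<and>
    continuous_map (arrows E) (arrows G) j \<and>
    open_map (arrows E) (arrows G) j \<and>
    j ` arrow_set E = arrow_set G \<and>
    homeomorphic_map (unit_space E) (unit_space G) j \<and>
    (\<forall>u\<in>units E. \<iota> (j u, 1) = u) \<and>
    {e \<in> arrow_set E. j e \<in> units G} = \<iota> ` arrow_set (trivial_circle_bundle G) \<and>
    (\<forall>e\<in>arrow_set E. \<forall>t\<in>circle.
       mult E (\<iota> (j (rng E e), t)) e = mult E e (\<iota> (j (src E e), t)))"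

definition twist_via ::
    "'g groupoid \<Rightarrow> 'e groupoid \<Rightarrow> ('g \<times> complex \<Rightarrow> 'e) \<Rightarrow> ('e \<Rightarrow> 'g) \<Rightarrow>
     (complex \<Rightarrow> 'e \<Rightarrow> 'e) \<Rightarrow> bool"
  where "twist_via G E \<iota> j a \<longleftrightarrow>
    twist G E \<iota> j \<and>
    (\<forall>t\<in>circle. \<forall>e\<in>arrow_set E. a t e = mult E (\<iota> (j (rng E e), t)) e)"

definition twist_equivalence ::
    "'g groupoid \<Rightarrow> 'e groupoid \<Rightarrow> ('g \<times> complex \<Rightarrow> 'e) \<Rightarrow> ('e \<Rightarrow> 'g) \<Rightarrow>
     'h groupoid \<Rightarrow> 'f groupoid \<Rightarrow> ('h \<times> complex \<Rightarrow> 'f) \<Rightarrow> ('f \<Rightarrow> 'h) \<Rightarrow>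
     ('e, 'z, 'f) bispace \<Rightarrow> bool"
  where "twist_equivalence G E \<iota> j G' E' \<iota>' j' Z \<longleftrightarrow>
    twist G E \<iota> j \<and> twist G' E' \<iota>' j' \<and>
    groupoid_equivalence E E' Z \<and>
    (\<forall>t\<in>circle. \<forall>z\<in>topspace (zspace Z).
       lact Z (\<iota> (j (lmoment Z z), t)) z = ract Z z (\<iota>' (j' (rmoment Z z), t)))"

end

theory Submission
  imports Defs
begin

text \<open>
  The circle acts on \<open>Z\<close> through \<open>E'\<close>, by \<open>z \<cdot> t = z \<cdot> \<iota>'(s(z), t)\<close>. Centrality of \<open>\<iota>'\<close> makes this
  action commute with both groupoid actions, so the unique arrow \<open>k(u, t)\<close> of \<open>E\<close> moving \<open>z\<close> to
  \<open>z \<cdot> t\<close> depends only on \<open>u = r(z)\<close>; the elements \<open>k(u, t)\<close> form a central circle bundle in \<open>E\<close>.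
  Continuity of \<open>k\<close> comes from the properness of the \<open>E\<close>-action and the openness of \<open>r\<close>. Dividing \<open>E\<close>
  by this circle gives \<open>G\<close>: as the circle is compact, the orbit map is open and perfect, so all
  topological requirements descend.
\<close>

section \<open>Groupoids and proper maps\<close>

lemma groupoid_hom_mult:
  assumes "groupoid_hom G H \<phi>" "x \<in> arrow_set G" "y \<in> arrow_set G" "src G x = rng G y"
  shows "src H (\<phi> x) = rng H (\<phi> y)" "\<phi> (mult G x y) = mult H (\<phi> x) (\<phi> y)"
  using assms by (auto simp: groupoid_hom_def)

lemma unit_props:
  assumes "u \<in> units G"
  shows "u \<in> arrow_set G" "rng G u = u" "src G u = u"
  using assms by (auto simp: units_def)

context
  fixes G :: "'g groupoid"
  assumes alg: "algebraic_groupoid G"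
begin

lemma rng_in_units: "x \<in> arrow_set G \<Longrightarrow> rng G x \<in> units G"
  and src_in_units: "x \<in> arrow_set G \<Longrightarrow> src G x \<in> units G"
  using alg by (auto simp: algebraic_groupoid_def)

lemma groupoid_mult_closed:
  assumes "x \<in> arrow_set G" "y \<in> arrow_set G" "src G x = rng G y"
  shows "mult G x y \<in> arrow_set G" "rng G (mult G x y) = rng G x" "src G (mult G x y) = src G y"
  using alg assms by (auto simp: algebraic_groupoid_def)

lemma groupoid_mult_assoc:
  assumes "x \<in> arrow_set G" "y \<in> arrow_set G" "z \<in> arrow_set G"
    "src G x = rng G y" "src G y = rng G z"
  shows "mult G (mult G x y) z = mult G x (mult G y z)"
  using alg assms by (simp add: algebraic_groupoid_def)

lemma groupoid_mult_units:
  assumes "x \<in> arrow_set G"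
  shows "mult G (rng G x) x = x" "mult G x (src G x) = x"
  using alg assms by (auto simp: algebraic_groupoid_def)

lemma ginv_props:
  assumes "x \<in> arrow_set G"
  shows "ginv G x \<in> arrow_set G" "rng G (ginv G x) = src G x" "src G (ginv G x) = rng G x"
    "mult G x (ginv G x) = rng G x" "mult G (ginv G x) x = src G x"
  using alg assms by (auto simp: algebraic_groupoid_def)

lemma ginv_unique:
  assumes x: "x \<in> arrow_set G" and y: "y \<in> arrow_set G"
    and s: "src G x = rng G y" and m: "mult G x y = rng G x"
  shows "y = ginv G x"
proof -
  have "y = mult G (mult G (ginv G x) x) y"
    using s groupoid_mult_units(1)[OF y] ginv_props(5)[OF x] by simp
  also have "\<dots> = mult G (ginv G x) (mult G x y)"
    using x y s by (intro groupoid_mult_assoc) (auto simp: ginv_props)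
  also have "\<dots> = ginv G x"
    using m groupoid_mult_units(2)[OF ginv_props(1)[OF x]] ginv_props(3)[OF x] by simp
  finally show ?thesis .
qed

end

lemma topspace_unit_space [simp]: "topspace (unit_space G) = units G"
  by (auto simp: unit_space_def units_def arrow_set_def)

lemma continuous_map_groupoid_mult:
  assumes "topological_groupoid G" "continuous_map X (arrows G) f" "continuous_map X (arrows G) g"
    and "\<And>x. x \<in> topspace X \<Longrightarrow> src G (f x) = rng G (g x)"
  shows "continuous_map X (arrows G) (\<lambda>x. mult G (f x) (g x))"
proof -
  have "continuous_map X (composable_space G) (\<lambda>x. (f x, g x))"
    using assms by (auto simp: composable_space_def continuous_map_in_subtopology continuous_map_paired)
  then show ?thesis
    using assms(1) continuous_map_compose[of X "composable_space G" "\<lambda>x. (f x, g x)" "arrows G" "\<lambda>(x, y). mult G x y"]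
    by (simp add: topological_groupoid_def o_def)
qed

lemma continuous_map_rng:
  assumes "topological_groupoid G"
  shows "continuous_map (arrows G) (unit_space G) (rng G)"
proof -
  have alg: "algebraic_groupoid G" and inv: "continuous_map (arrows G) (arrows G) (ginv G)"
    using assms by (auto simp: topological_groupoid_def)
  have "continuous_map (arrows G) (arrows G) (\<lambda>x. mult G x (ginv G x))"
    using ginv_props[OF alg] inv
    by (intro continuous_map_groupoid_mult assms) (auto simp: arrow_set_def)
  then have "continuous_map (arrows G) (arrows G) (rng G)"
    by (rule continuous_map_eq) (use ginv_props[OF alg] in \<open>auto simp: arrow_set_def\<close>)
  then show ?thesis
    using rng_in_units[OF alg] by (auto simp: unit_space_def continuous_map_in_subtopology arrow_set_def)
qed

section \<open>Proper and perfect maps of locally compact Hausdorff spaces\<close>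

lemma compact_space_circle: "compact_space (top_of_set circle)"
  by (simp add: compact_space_subtopology)

lemma proper_map_eq:
  assumes "proper_map X Y f" "\<And>x. x \<in> topspace X \<Longrightarrow> f x = g x"
  shows "proper_map X Y g"
proof -
  have "{x \<in> topspace X. f x = y} = {x \<in> topspace X. g x = y}" for y
    using assms(2) by auto
  then show ?thesis
    using assms closed_map_eq[of X Y f g] by (auto simp: proper_map_def)
qed

lemma proper_map_fst_compact:
  assumes "compact_space Y"
  shows "proper_map (prod_topology X Y) X fst"
  unfolding proper_map_def
proof (intro conjI ballI)
  show "closed_map (prod_topology X Y) X fst"
    using assms by (rule Abstract_Topological_Spaces.closed_map_fst)
  fix x assume "x \<in> topspace X"
  then have "compactin (prod_topology X Y) ({x} \<times> topspace Y)"
    using assms by (simp add: compactin_Times compact_space_def)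
  moreover have "{p \<in> topspace (prod_topology X Y). fst p = x} = {x} \<times> topspace Y"
    using \<open>x \<in> topspace X\<close> by auto
  ultimately show "compactin (prod_topology X Y) {p \<in> topspace (prod_topology X Y). fst p = x}"
    by simp
qed

text \<open>Bridges the two notions of properness. A locally compact Hausdorff target is a k-space
  whose compact sets are closed, so compactness of preimages already forces the map to be
  closed.\<close>

lemma compact_preimages_imp_proper_map:
  assumes "lch_space Y" "continuous_map X Y f" "compact_preimages X Y f"
  shows "proper_map X Y f"
  using assms unfolding lch_space_def compact_preimages_def
  by (intro compact_imp_proper_map)
    (auto simp: locally_compact_imp_k_space Hausdorff_imp_kc_space dest: continuous_map_funspace)

lemma lch_space_prod: "lch_space X \<Longrightarrow> lch_space Y \<Longrightarrow> lch_space (prod_topology X Y)"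
  by (simp add: lch_space_def locally_compact_space_prod_topology Hausdorff_space_prod_topology)

text \<open>Openness carries local compactness to the image. The Hausdorff property is reached
  through regularity, which perfect maps preserve, together with T1, which closed maps
  preserve.\<close>

lemma lch_space_open_perfect_image:
  assumes X: "lch_space X" and f: "perfect_map X Y f" and "open_map X Y f"
  shows "lch_space Y"
proof -
  have "regular_space X" "t1_space X" "locally_compact_space X"
    using X by (auto simp: lch_space_def locally_compact_Hausdorff_imp_regular_space Hausdorff_imp_t1_space)
  moreover have "continuous_map X Y f" "closed_map X Y f" "f ` topspace X = topspace Y"
    using f by (auto simp: perfect_map_def proper_map_def)
  ultimately show ?thesis
    unfolding lch_space_def
    by (meson assms f locally_compact_space_continuous_open_map_image regular_space_perfect_map_image
        regular_t1_imp_Hausdorff_space t1_space_closed_map_image)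
qed

section \<open>Quotient of a groupoid by a central circle\<close>

text \<open>
  \<open>k u t\<close> plays the role of \<open>\<iota>(u, t)\<close> before the quotient groupoid exists.
\<close>

locale central_circle =
  fixes E :: "'e groupoid" and k :: "'e \<Rightarrow> complex \<Rightarrow> 'e"
  assumes lch: "lch_groupoid E"
    and k_continuous: "continuous_map (prod_topology (unit_space E) (top_of_set circle)) (arrows E) (\<lambda>(u, t). k u t)"
    and k_rng: "\<And>u t. u \<in> units E \<Longrightarrow> t \<in> circle \<Longrightarrow> rng E (k u t) = u"
    and k_src: "\<And>u t. u \<in> units E \<Longrightarrow> t \<in> circle \<Longrightarrow> src E (k u t) = u"
    and k_one: "\<And>u. u \<in> units E \<Longrightarrow> k u 1 = u"
    and k_mult: "\<And>u s t. u \<in> units E \<Longrightarrow> s \<in> circle \<Longrightarrow> t \<in> circle \<Longrightarrow>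
      mult E (k u s) (k u t) = k u (s * t)"
    and k_free: "\<And>u t. u \<in> units E \<Longrightarrow> t \<in> circle \<Longrightarrow> k u t = u \<Longrightarrow> t = 1"
    and k_central: "\<And>e t. e \<in> arrow_set E \<Longrightarrow> t \<in> circle \<Longrightarrow>
      mult E (k (rng E e) t) e = mult E e (k (src E e) t)"
begin

section \<open>The circle action on \<open>E\<close>\<close>

lemma top: "topological_groupoid E" and alg: "algebraic_groupoid E"
  using lch by (auto simp: lch_groupoid_def topological_groupoid_def)

lemmas E_rules = rng_in_units[OF alg] src_in_units[OF alg] groupoid_mult_closed[OF alg]
  groupoid_mult_units[OF alg] ginv_props[OF alg] unit_props

lemma k_closed: "u \<in> units E \<Longrightarrow> t \<in> circle \<Longrightarrow> k u t \<in> arrow_set E"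
  using continuous_map_funspace[OF k_continuous] by (force simp: arrow_set_def Pi_iff)

definition act :: "complex \<Rightarrow> 'e \<Rightarrow> 'e"
  where "act t e = mult E (k (rng E e) t) e"

lemma act_closed:
  assumes "e \<in> arrow_set E" "t \<in> circle"
  shows "act t e \<in> arrow_set E" "rng E (act t e) = rng E e" "src E (act t e) = src E e"
  using assms by (auto simp: act_def E_rules k_closed k_rng k_src)

lemma act_one: "e \<in> arrow_set E \<Longrightarrow> act 1 e = e"
  by (simp add: act_def k_one E_rules)

lemma circle_mult: "s \<in> circle \<Longrightarrow> t \<in> circle \<Longrightarrow> s * t \<in> circle"
  and circle_inverse: "t \<in> circle \<Longrightarrow> inverse t \<in> circle"
  and circle_one: "1 \<in> circle"
  by (auto simp: norm_mult norm_inverse)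

lemma act_act:
  assumes "e \<in> arrow_set E" "s \<in> circle" "t \<in> circle"
  shows "act s (act t e) = act (s * t) e"
proof -
  have "act s (act t e) = mult E (k (rng E e) s) (mult E (k (rng E e) t) e)"
    using act_closed(2)[of e t] assms by (simp add: act_def)
  also have "\<dots> = mult E (mult E (k (rng E e) s) (k (rng E e) t)) e"
    using assms by (intro groupoid_mult_assoc[OF alg, symmetric]) (auto simp: E_rules k_closed k_rng k_src)
  finally show ?thesis
    using assms by (simp add: act_def k_mult E_rules)
qed

lemma act_inverse:
  assumes "e \<in> arrow_set E" "t \<in> circle"
  shows "act (inverse t) (act t e) = e"
proof -
  have "t \<noteq> 0" using assms by auto
  then show ?thesis
    using assms circle_inverse[of t] by (auto simp: act_act act_one)
qed

text \<open>Centrality moves the scalar on \<open>y\<close> across \<open>x\<close>, so both scalars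
  collect at the range of the product. This is what makes multiplication descend to orbits.\<close>

lemma act_mult:
  assumes x: "x \<in> arrow_set E" and y: "y \<in> arrow_set E" and xy: "src E x = rng E y"
    and s: "s \<in> circle" and t: "t \<in> circle"
  shows "mult E (act s x) (act t y) = act (s * t) (mult E x y)"
proof -
  note rules = E_rules k_closed k_rng k_src act_closed
  have "mult E x (act t y) = mult E (mult E x (k (src E x) t)) y"
    unfolding act_def using assms by (subst groupoid_mult_assoc[OF alg]) (auto simp: rules)
  also have "\<dots> = mult E (mult E (k (rng E x) t) x) y"
    using assms by (simp add: k_central)
  also have "\<dots> = act t (mult E x y)"
    unfolding act_def using assms by (subst groupoid_mult_assoc[OF alg]) (auto simp: rules)
  finally have *: "mult E x (act t y) = act t (mult E x y)" .
  have "mult E (act s x) (act t y) = mult E (k (rng E x) s) (mult E x (act t y))"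
    unfolding act_def[of s] using assms by (subst groupoid_mult_assoc[OF alg]) (auto simp: rules)
  also have "\<dots> = act s (act t (mult E x y))"
    unfolding * using assms by (simp add: act_def[of s] rules)
  finally show ?thesis
    using assms by (simp add: act_act rules)
qed

text \<open>Multiplying \<open>act t e = e\<close> by the inverse of \<open>e\<close> reduces
  freeness on all arrows to the hypothesis \<open>k_free\<close> at the unit
  \<open>rng E e\<close>.\<close>

lemma act_free:
  assumes e: "e \<in> arrow_set E" and t: "t \<in> circle" and eq: "act t e = e"
  shows "t = 1"
proof -
  note rules = E_rules k_closed k_rng k_src
  have "k (rng E e) t = mult E (k (rng E e) t) (mult E e (ginv E e))"
    using e t groupoid_mult_units(2)[OF alg, of "k (rng E e) t"] by (simp add: rules)
  also have "\<dots> = mult E (act t e) (ginv E e)"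
    unfolding act_def using e t by (subst groupoid_mult_assoc[OF alg]) (auto simp: rules)
  also have "\<dots> = rng E e"
    using e eq by (simp add: rules)
  finally show ?thesis
    using e t by (intro k_free) (auto simp: rules)
qed

lemma act_unit: "u \<in> units E \<Longrightarrow> t \<in> circle \<Longrightarrow> act t u = k u t"
  using groupoid_mult_units(2)[OF alg k_closed[of u t]] by (simp add: act_def unit_props k_src)

lemma act_continuous: "continuous_map (prod_topology (top_of_set circle) (arrows E)) (arrows E) (\<lambda>(t, e). act t e)"
proof -
  have "continuous_map (prod_topology (top_of_set circle) (arrows E)) (unit_space E) (rng E \<circ> snd)"
    by (rule continuous_map_compose[OF continuous_map_snd continuous_map_rng[OF top]])
  then have "continuous_map (prod_topology (top_of_set circle) (arrows E))
      (prod_topology (unit_space E) (top_of_set circle)) (\<lambda>p. (rng E (snd p), fst p))"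
    by (simp add: continuous_map_paired continuous_map_fst o_def)
  from continuous_map_compose[OF this k_continuous]
  have "continuous_map (prod_topology (top_of_set circle) (arrows E)) (arrows E)
      (\<lambda>p. mult E (k (rng E (snd p)) (fst p)) (snd p))"
    by (intro continuous_map_groupoid_mult[OF top])
      (auto simp: o_def continuous_map_snd k_src E_rules arrow_set_def[symmetric])
  then show ?thesis
    by (simp add: act_def case_prod_unfold)
qed

lemma principal_act: "principal_circle_action (arrows E) act"
  unfolding principal_circle_action_def arrow_set_def[symmetric]
  using act_continuous act_one act_act act_free by auto

section \<open>Orbits and the algebraic quotient groupoid\<close>

definition orb :: "'e \<Rightarrow> 'e set"
  where "orb e = (\<lambda>t. act t e) ` circle"

lemma orb_eq_iff:
  assumes "e \<in> arrow_set E" "f \<in> arrow_set E"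
  shows "orb e = orb f \<longleftrightarrow> (\<exists>t\<in>circle. f = act t e)"
proof
  assume "orb e = orb f"
  moreover have "f \<in> orb f"
    using act_one[OF assms(2)] circle_one unfolding orb_def by (metis image_eqI)
  ultimately show "\<exists>t\<in>circle. f = act t e"
    by (auto simp: orb_def)
next
  assume "\<exists>t\<in>circle. f = act t e"
  then obtain t where t: "t \<in> circle" "f = act t e" by auto
  have "act s e = act (s * inverse t) f" "act s f = act (s * t) e" if "s \<in> circle" for s
    using t that assms act_inverse[OF assms(1) t(1)] circle_inverse[OF t(1)]
      act_act[OF assms(2) that circle_inverse[OF t(1)]] act_act[OF assms(1) that t(1)] by auto
  then show "orb e = orb f"
    using t circle_mult circle_inverse[OF t(1)] unfolding orb_def by (safe; metis image_eqI)
qed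

lemma orb_act: "e \<in> arrow_set E \<Longrightarrow> t \<in> circle \<Longrightarrow> orb (act t e) = orb e"
  using orb_eq_iff act_closed(1) by metis

text \<open>An arbitrary section of \<open>orb\<close>, with no continuity. Continuity statements
  below are therefore proved after composing with \<open>orb\<close>, where the choice
  disappears.\<close>

definition rep :: "'e set \<Rightarrow> 'e"
  where "rep = inv_into (arrow_set E) orb"

lemma rep_orb:
  assumes "e \<in> arrow_set E"
  obtains t where "t \<in> circle" "rep (orb e) = act t e"
proof -
  have "orb (rep (orb e)) = orb e" "rep (orb e) \<in> arrow_set E"
    using assms by (auto simp: rep_def f_inv_into_f inv_into_into)
  then show ?thesis
    using that assms orb_eq_iff by metis
qed

lemma rng_src_rep_orb:
  assumes "e \<in> arrow_set E"
  shows "rng E (rep (orb e)) = rng E e" "src E (rep (orb e)) = src E e"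
  using assms by (metis rep_orb act_closed)+

text \<open>The arrows are the orbits themselves, as sets. Operations are computed on chosen
  representatives; \<open>rng_orb\<close>, \<open>src_orb\<close>, \<open>mult_orb\<close> and
  \<open>ginv_orb\<close> show that the choice is immaterial.\<close>

definition quotient_groupoid :: "'e set groupoid"
  where "quotient_groupoid =
    \<lparr>arrows = quotient_space (arrows E) orb,
     rng = (\<lambda>X. orb (rng E (rep X))),
     src = (\<lambda>X. orb (src E (rep X))),
     mult = (\<lambda>X Y. orb (mult E (rep X) (rep Y))),
     ginv = (\<lambda>X. orb (ginv E (rep X)))\<rparr>"

abbreviation "Q \<equiv> quotient_groupoid"

lemma arrow_set_Q: "arrow_set Q = orb ` arrow_set E"
  by (simp add: arrow_set_def quotient_groupoid_def topspace_quotient_space)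

lemma rng_orb: "e \<in> arrow_set E \<Longrightarrow> rng Q (orb e) = orb (rng E e)"
  and src_orb: "e \<in> arrow_set E \<Longrightarrow> src Q (orb e) = orb (src E e)"
  by (simp_all add: quotient_groupoid_def rng_src_rep_orb)

text \<open>The chosen representatives differ from \<open>x\<close> and \<open>y\<close> by scalars
  \<open>s\<close> and \<open>t\<close>, and by \<open>act_mult\<close> their product differs from
  the product of \<open>x\<close> and \<open>y\<close> by \<open>s * t\<close> only.\<close>

lemma mult_orb:
  assumes "x \<in> arrow_set E" "y \<in> arrow_set E" "src E x = rng E y"
  shows "mult Q (orb x) (orb y) = orb (mult E x y)"
proof -
  obtain s where s: "s \<in> circle" "rep (orb x) = act s x" using rep_orb assms by blast
  obtain t where t: "t \<in> circle" "rep (orb y) = act t y" using rep_orb assms by blast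
  show ?thesis
    using assms s t by (simp add: quotient_groupoid_def act_mult orb_act E_rules norm_mult)
qed

lemma ginv_act:
  assumes "e \<in> arrow_set E" "t \<in> circle"
  shows "ginv E (act t e) = act (inverse t) (ginv E e)"
proof (rule ginv_unique[OF alg, symmetric])
  have "t \<noteq> 0" using assms by auto
  then show "mult E (act t e) (act (inverse t) (ginv E e)) = rng E (act t e)"
    using assms circle_inverse[of t] by (simp add: act_mult act_closed act_one E_rules)
qed (use assms circle_inverse[of t] in \<open>auto simp: act_closed E_rules\<close>)

lemma ginv_orb:
  assumes "e \<in> arrow_set E"
  shows "ginv Q (orb e) = orb (ginv E e)"
proof -
  obtain t where t: "t \<in> circle" "rep (orb e) = act t e" using rep_orb assms by blast
  show ?thesis
    using assms t circle_inverse[of t] by (simp add: quotient_groupoid_def ginv_act orb_act E_rules)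
qed

text \<open>The action preserves ranges and a unit is its own range. Hence composability of two
  orbits is the same as composability of any representatives, with no adjustment by a
  scalar.\<close>

lemma orb_unit_eq:
  assumes "u \<in> units E" "v \<in> units E" "orb u = orb v"
  shows "u = v"
  using assms by (metis act_closed(2) orb_eq_iff unit_props(1,2))

lemma src_rng_orb_eq:
  assumes "x \<in> arrow_set E" "y \<in> arrow_set E"
  shows "src Q (orb x) = rng Q (orb y) \<longleftrightarrow> src E x = rng E y"
  using assms orb_unit_eq by (auto simp: rng_orb src_orb E_rules)

lemma units_Q: "units Q = orb ` units E"
proof
  show "units Q \<subseteq> orb ` units E"
  proof
    fix X assume "X \<in> units Q"
    then have X: "X \<in> arrow_set Q" "rng Q X = X" by (simp_all add: units_def)
    then obtain e where e: "e \<in> arrow_set E" "X = orb e" unfolding arrow_set_Q by blast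
    then have "X = orb (rng E e)" using X(2) rng_orb by metis
    then show "X \<in> orb ` units E" using e(1) E_rules(1) by blast
  qed
  show "orb ` units E \<subseteq> units Q"
  proof
    fix X assume "X \<in> orb ` units E"
    then obtain u where u: "u \<in> units E" "X = orb u" by blast
    then show "X \<in> units Q"
      using rng_orb[of u] src_orb[of u] unit_props[OF u(1)] unfolding units_def[of Q] arrow_set_Q by simp
  qed
qed

text \<open>Every arrow of \<open>Q\<close> is an orbit, so \<open>ball_simps(9)\<close> turns each
  axiom into a statement about arrows of \<open>E\<close>, where the corresponding axiom
  holds.\<close>

lemma algebraic_Q: "algebraic_groupoid Q"
  unfolding algebraic_groupoid_def arrow_set_Q units_Q ball_simps(9)
proof (intro conjI ballI impI)
  fix x y assume xy: "x \<in> arrow_set E" "y \<in> arrow_set E" "src Q (orb x) = rng Q (orb y)"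
  then have "src E x = rng E y" by (simp add: src_rng_orb_eq)
  then show "mult Q (orb x) (orb y) \<in> orb ` arrow_set E"
    "rng Q (mult Q (orb x) (orb y)) = rng Q (orb x)" "src Q (mult Q (orb x) (orb y)) = src Q (orb y)"
    using xy by (auto simp: mult_orb rng_orb src_orb E_rules)
next
  fix x y z assume *: "x \<in> arrow_set E" "y \<in> arrow_set E" "z \<in> arrow_set E"
    "src Q (orb x) = rng Q (orb y) \<and> src Q (orb y) = rng Q (orb z)"
  then have "src E x = rng E y" "src E y = rng E z" by (simp_all add: src_rng_orb_eq)
  then show "mult Q (mult Q (orb x) (orb y)) (orb z) = mult Q (orb x) (mult Q (orb y) (orb z))"
    using * by (simp add: mult_orb E_rules groupoid_mult_assoc[OF alg])
qed (auto simp: rng_orb src_orb ginv_orb mult_orb E_rules)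

section \<open>Topology of the quotient groupoid\<close>

lemma arrows_Q: "arrows Q = quotient_space (arrows E) orb"
  by (simp add: quotient_groupoid_def)

lemma orb_quotient: "quotient_map (arrows E) (arrows Q) orb"
  by (simp add: arrows_Q quotient_map_quotient_space)

lemma orb_continuous: "continuous_map (arrows E) (arrows Q) orb"
  using orb_quotient by (rule quotient_imp_continuous_map)

text \<open>Writes the saturation of \<open>U\<close> as the projection along the circle of a
  preimage under the action. Openness and closedness of \<open>orb\<close> then both follow from the
  same property of that projection.\<close>

lemma orb_saturation:
  assumes "U \<subseteq> arrow_set E"
  shows "{e \<in> arrow_set E. orb e \<in> orb ` U} =
    snd ` {p \<in> topspace (prod_topology (top_of_set circle) (arrows E)). (\<lambda>(t, e). act t e) p \<in> U}"
    (is "?L = ?R")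
proof
  show "?L \<subseteq> ?R"
  proof
    fix e assume e: "e \<in> ?L"
    then obtain f where f: "f \<in> U" "orb e = orb f" by auto
    then have "f \<in> arrow_set E" using assms by auto
    then obtain t where "t \<in> circle" "f = act t e" using orb_eq_iff[of e f] e f by blast
    then show "e \<in> ?R" using e f by (intro image_eqI[of _ _ "(t, e)"]) (auto simp: arrow_set_def)
  qed
  show "?R \<subseteq> ?L"
    using orb_act by (auto simp: arrow_set_def) (metis image_eqI mem_sphere_0)
qed

lemma orb_open: "open_map (arrows E) (arrows Q) orb"
  unfolding open_map_def arrows_Q openin_quotient_space arrow_set_def[symmetric]
proof (intro allI impI conjI)
  fix U assume U: "openin (arrows E) U"
  then show "orb ` U \<subseteq> orb ` arrow_set E" using openin_subset arrow_set_def by fast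
  have "openin (arrows E)
    (snd ` {p \<in> topspace (prod_topology (top_of_set circle) (arrows E)). (\<lambda>(t, e). act t e) p \<in> U})"
    using open_map_snd openin_continuous_map_preimage[OF act_continuous U] unfolding open_map_def by blast
  then show "openin (arrows E) {x \<in> arrow_set E. orb x \<in> orb ` U}"
    using orb_saturation openin_subset[OF U] by (simp add: arrow_set_def)
qed

text \<open>Compactness of the circle enters twice: projection along it is closed, and each fibre of
  \<open>orb\<close> is a continuous image of it.\<close>

lemma orb_perfect: "perfect_map (arrows E) (arrows Q) orb"
proof -
  have "closed_map (arrows E) (arrows Q) orb"
    unfolding closed_map_def
  proof (intro allI impI)
    fix U assume U: "closedin (arrows E) U"
    have "closedin (arrows E)
      (snd ` {p \<in> topspace (prod_topology (top_of_set circle) (arrows E)). (\<lambda>(t, e). act t e) p \<in> U})"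
      using Abstract_Topological_Spaces.closed_map_snd[OF compact_space_circle]
        closedin_continuous_map_preimage[OF act_continuous U] unfolding closed_map_def by blast
    then have "closedin (arrows E) {x \<in> topspace (arrows E). orb x \<in> orb ` U}"
      using orb_saturation closedin_subset[OF U] by (simp add: arrow_set_def)
    moreover have "orb ` U \<subseteq> topspace (arrows Q)"
      using closedin_subset[OF U] by (auto simp: arrows_Q topspace_quotient_space)
    ultimately show "closedin (arrows Q) (orb ` U)"
      using orb_quotient by (simp add: quotient_map_closedin)
  qed
  moreover have "compactin (arrows E) {x \<in> topspace (arrows E). orb x = y}" if y: "y \<in> topspace (arrows Q)" for y
  proof -
    obtain e where e: "e \<in> arrow_set E" "y = orb e"
      using y arrow_set_Q arrow_set_def by (metis imageE)
    have "continuous_map (top_of_set circle) (prod_topology (top_of_set circle) (arrows E)) (\<lambda>t. (t, e))"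
      using e by (simp add: continuous_map_paired arrow_set_def continuous_map_id[unfolded id_def])
    from continuous_map_compose[OF this act_continuous]
    have "continuous_map (top_of_set circle) (arrows E) (\<lambda>t. act t e)" by (simp add: o_def)
    then have "compactin (arrows E) ((\<lambda>t. act t e) ` circle)"
      using image_compactin compact_space_circle by (metis compact_space_def topspace_euclidean_subtopology)
    moreover have "{x \<in> topspace (arrows E). orb x = y} = (\<lambda>t. act t e) ` circle"
      using e act_closed(1)[OF e(1)] orb_eq_iff[OF e(1)] orb_act[OF e(1)]
      unfolding arrow_set_def by (auto; metis image_eqI mem_sphere_0)
    ultimately show ?thesis by simp
  qed
  ultimately show ?thesis
    using orb_continuous orb_quotient by (simp add: perfect_map_def proper_map_def quotient_imp_surjective_map)
qed

lemma lch_Q: "lch_space (arrows Q)"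
  using lch_space_open_perfect_image[OF _ orb_perfect orb_open] lch by (simp add: lch_groupoid_def)

text \<open>Multiplication descends once \<open>orb\<close> on pairs is a quotient map between the
  spaces of composable pairs. Products and restrictions of quotient maps need not be quotient maps,
  but proper maps are stable under products and under restriction to full preimages.\<close>

lemma topological_Q: "topological_groupoid Q"
  unfolding topological_groupoid_def
proof (intro conjI algebraic_Q)
  let ?q = "\<lambda>(x, y). (orb x, orb y)"
  have "proper_map (prod_topology (arrows E) (arrows E)) (prod_topology (arrows Q) (arrows Q)) ?q"
    using orb_perfect by (simp add: proper_map_prod perfect_map_def)
  \<comment> \<open>The composable pairs of \<open>E\<close> are the full preimage of those of
    \<open>Q\<close>, as the restriction of a proper map requires.\<close>
  moreover have "{p \<in> topspace (prod_topology (arrows E) (arrows E)). ?q p \<in> {(x, y). src Q x = rng Q y}} =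
      topspace (prod_topology (arrows E) (arrows E)) \<inter> {(x, y). src E x = rng E y}"
    using src_rng_orb_eq by (auto simp: arrow_set_def)
  ultimately have "proper_map (subtopology (prod_topology (arrows E) (arrows E))
      (topspace (prod_topology (arrows E) (arrows E)) \<inter> {(x, y). src E x = rng E y})) (composable_space Q) ?q"
    unfolding composable_space_def by (rule proper_map_restriction)
  then have proper: "proper_map (composable_space E) (composable_space Q) ?q"
    unfolding composable_space_def[of E] by (simp only: subtopology_restrict)
  have cont: "continuous_map (composable_space E) (composable_space Q) ?q"
    using orb_continuous src_rng_orb_eq unfolding composable_space_def continuous_map_in_subtopology
    by (auto simp: continuous_map_prod_top arrow_set_def intro!: continuous_map_from_subtopology)
  have surj: "?q ` topspace (composable_space E) = topspace (composable_space Q)"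
    using src_rng_orb_eq arrow_set_Q unfolding composable_space_def
    by (auto simp: arrow_set_def image_iff)
  have quot: "quotient_map (composable_space E) (composable_space Q) ?q"
    using proper cont surj by (intro continuous_closed_imp_quotient_map) (auto simp: proper_map_def)
  have "continuous_map (composable_space E) (arrows Q) (orb \<circ> (\<lambda>(x, y). mult E x y))"
    using top orb_continuous by (intro continuous_map_compose) (auto simp: topological_groupoid_def)
  then have "continuous_map (composable_space E) (arrows Q) ((\<lambda>(x, y). mult Q x y) \<circ> ?q)"
    by (rule continuous_map_eq) (auto simp: composable_space_def mult_orb arrow_set_def)
  then show "continuous_map (composable_space Q) (arrows Q) (\<lambda>(x, y). mult Q x y)"
    by (rule continuous_compose_quotient_map[OF quot])
  have "continuous_map (arrows E) (arrows Q) (orb \<circ> ginv E)"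
    using top orb_continuous by (intro continuous_map_compose) (auto simp: topological_groupoid_def)
  then have "continuous_map (arrows E) (arrows Q) (ginv Q \<circ> orb)"
    by (rule continuous_map_eq) (simp add: ginv_orb arrow_set_def)
  then show "continuous_map (arrows Q) (arrows Q) (ginv Q)"
    by (rule continuous_compose_quotient_map[OF orb_quotient])
qed

text \<open>Although \<open>rep\<close> is arbitrary, \<open>rng E\<close> is constant on orbits, so
  composing with \<open>orb\<close> gives \<open>rng E\<close> back and continuity descends. On
  units this map is the inverse of \<open>orb\<close>.\<close>

lemma rng_rep_continuous: "continuous_map (unit_space Q) (unit_space E) (rng E \<circ> rep)"
proof -
  have "continuous_map (arrows E) (unit_space E) ((rng E \<circ> rep) \<circ> orb)"
    using continuous_map_rng[OF top]
    by (rule continuous_map_eq) (simp add: rng_src_rep_orb arrow_set_def)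
  then have "continuous_map (arrows Q) (unit_space E) (rng E \<circ> rep)"
    by (rule continuous_compose_quotient_map[OF orb_quotient])
  then show ?thesis
    unfolding unit_space_def[of Q] by (rule continuous_map_from_subtopology)
qed

lemma orb_units_homeomorphism: "homeomorphic_map (unit_space E) (unit_space Q) orb"
proof -
  have cont: "continuous_map (unit_space E) (unit_space Q) orb"
    using orb_continuous units_Q
    by (auto simp: unit_space_def continuous_map_in_subtopology continuous_map_from_subtopology)
  with rng_rep_continuous have "homeomorphic_maps (unit_space E) (unit_space Q) orb (rng E \<circ> rep)"
    by (auto simp: homeomorphic_maps_def units_Q rng_src_rep_orb unit_props)
  then show ?thesis by (auto simp: homeomorphic_map_maps)
qed

lemma lch_groupoid_Q: "lch_groupoid Q"
proof -
  \<comment> \<open>One argument serves both range and source: \<open>g\<close> after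
    \<open>orb\<close> equals \<open>orb\<close> after \<open>f\<close>, which is open, and
    \<open>orb\<close> is a continuous surjection, so \<open>g\<close> is open.\<close>
  have *: "open_map (arrows Q) (unit_space Q) g"
    if "open_map (arrows E) (unit_space E) f" "\<And>x. x \<in> arrow_set E \<Longrightarrow> g (orb x) = orb (f x)" for f g
  proof -
    have "open_map (arrows E) (unit_space Q) (orb \<circ> f)"
      using that(1) homeomorphic_imp_open_map[OF orb_units_homeomorphism] by (rule open_map_compose)
    then have "open_map (arrows E) (unit_space Q) (g \<circ> orb)"
      by (rule open_map_eq) (simp add: that arrow_set_def)
    then show ?thesis
      by (rule open_map_from_composition_left[OF _ orb_continuous quotient_imp_surjective_map[OF orb_quotient]])
  qed
  show ?thesis
    using topological_Q lch_Q *[of "rng E" "rng Q"] *[of "src E" "src Q"] lch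
    by (simp add: lch_groupoid_def rng_orb src_orb)
qed

section \<open>The twist structure on \<open>E\<close>\<close>

text \<open>A unit of \<open>Q\<close> is the orbit of a unique unit of \<open>E\<close>, and
  \<open>rng E (rep _)\<close> recovers that unit. So this is \<open>k\<close>, reindexed by the
  units of the quotient.\<close>

definition incl :: "'e set \<times> complex \<Rightarrow> 'e"
  where "incl p = k (rng E (rep (fst p))) (snd p)"

lemma incl_orb: "u \<in> units E \<Longrightarrow> incl (orb u, t) = k u t"
  by (simp add: incl_def rng_src_rep_orb unit_props)

lemma k_inj:
  assumes "u \<in> units E" "s \<in> circle" "t \<in> circle" "k u s = k u t"
  shows "s = t"
proof -
  have t: "t \<noteq> 0" "inverse t \<in> circle" using assms circle_inverse by auto
  have "k u (inverse t * s) = k u (inverse t * t)"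
    using assms t k_mult[of u "inverse t"] by metis
  then have "inverse t * s = 1"
    using assms t k_one circle_mult by (intro k_free[of u]) auto
  then show ?thesis using t by (simp add: field_simps)
qed

lemma twist_Q: "twist Q E incl orb"
  unfolding twist_def
proof (intro conjI)
  let ?T = "trivial_circle_bundle Q"
  have arr: "arrows ?T = prod_topology (unit_space Q) (top_of_set circle)"
    and arrT: "arrow_set ?T = (orb ` units E) \<times> circle"
    by (auto simp: trivial_circle_bundle_def arrow_set_def units_Q)
  show "lch_groupoid Q" "lch_groupoid E" by (rule lch_groupoid_Q, rule lch)
  show "groupoid_hom ?T E incl"
    unfolding groupoid_hom_def arrT
    by (auto simp: trivial_circle_bundle_def incl_orb k_closed k_rng k_src k_mult dest!: orb_unit_eq)
  show "groupoid_hom E Q orb"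
    by (auto simp: groupoid_hom_def arrow_set_Q src_orb rng_orb mult_orb)
  show "continuous_map (arrows E) (arrows Q) orb" by (rule orb_continuous)
  show "open_map (arrows E) (arrows Q) orb" by (rule orb_open)
  show "orb ` arrow_set E = arrow_set Q" by (simp add: arrow_set_Q)
  show hom: "homeomorphic_map (unit_space E) (unit_space Q) orb" by (rule orb_units_homeomorphism)
  show "\<forall>u\<in>units E. incl (orb u, 1) = u" by (simp add: incl_orb k_one)
  show "\<forall>e\<in>arrow_set E. \<forall>t\<in>circle. mult E (incl (orb (rng E e), t)) e = mult E e (incl (orb (src E e), t))"
    by (simp add: incl_orb k_central E_rules)
  show "{e \<in> arrow_set E. orb e \<in> units Q} = incl ` arrow_set ?T"
  proof (intro set_eqI iffI)
    fix e assume "e \<in> {e \<in> arrow_set E. orb e \<in> units Q}"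
    \<comment> \<open>If the orbit of \<open>e\<close> is a unit, it is the orbit of some unit
      \<open>u\<close> of \<open>E\<close>, so \<open>e\<close> is a scalar multiple of
      \<open>u\<close>, which is \<open>k u t\<close> by \<open>act_unit\<close>.\<close>
    then obtain u where u: "e \<in> arrow_set E" "u \<in> units E" "orb u = orb e" by (auto simp: units_Q)
    then obtain t where "t \<in> circle" "e = k u t"
      using orb_eq_iff[of u e] act_unit by (auto simp: unit_props)
    then show "e \<in> incl ` arrow_set ?T"
      using u(2) by (intro image_eqI[of _ _ "(orb u, t)"]) (auto simp: arrT incl_orb)
  next
    fix e assume "e \<in> incl ` arrow_set ?T"
    then obtain u t where "u \<in> units E" "t \<in> circle" "e = k u t" by (auto simp: arrT incl_orb)
    then show "e \<in> {e \<in> arrow_set E. orb e \<in> units Q}"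
      using orb_act[of u t] act_unit[of u t] by (auto simp: k_closed units_Q unit_props)
  qed
  \<comment> \<open>The embedding property is obtained from properness: following
    \<open>incl\<close> by the range map gives the projection of the bundle onto
    \<open>unit_space Q\<close>, proper since the circle is compact. As \<open>E\<close> is
    Hausdorff, \<open>incl\<close> is itself proper, hence closed, and it is injective.\<close>
  have "continuous_map (arrows E) (unit_space Q) (orb \<circ> rng E)"
    using continuous_map_rng[OF top] homeomorphic_imp_continuous_map[OF hom] by (rule continuous_map_compose)
  moreover have cont: "continuous_map (arrows ?T) (arrows E) incl"
  proof -
    from continuous_map_compose[OF continuous_map_fst[of "unit_space Q" "top_of_set circle"] rng_rep_continuous]
    have "continuous_map (arrows ?T) (prod_topology (unit_space E) (top_of_set circle))
        (\<lambda>p. (rng E (rep (fst p)), snd p))"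
      unfolding arr by (simp add: continuous_map_paired continuous_map_snd o_def)
    from continuous_map_compose[OF this k_continuous] show ?thesis
      by (simp add: o_def incl_def[abs_def])
  qed
  moreover have "Hausdorff_space (arrows E)"
    using lch by (simp add: lch_groupoid_def lch_space_def)
  moreover have "proper_map (arrows ?T) (unit_space Q) ((orb \<circ> rng E) \<circ> incl)"
    using proper_map_fst_compact[OF compact_space_circle, of "unit_space Q"] unfolding arr
    by (rule proper_map_eq) (auto simp: units_Q incl_orb k_rng)
  ultimately have "proper_map (arrows ?T) (arrows E) incl"
    by (metis proper_map_from_composition_right)
  moreover have "inj_on incl (topspace (arrows ?T))"
    unfolding arrow_set_def[symmetric] arrT
    using k_rng k_inj by (auto intro!: inj_onI simp: incl_orb; metis mem_sphere_0)
  ultimately show "embedding_map (arrows ?T) (arrows E) incl"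
    using cont by (intro injective_closed_imp_embedding_map) (auto simp: proper_map_def)
qed

lemma twist_via_Q: "twist_via Q E incl orb act"
  by (simp add: twist_via_def twist_Q act_def incl_orb E_rules)

end

section \<open>Translation maps of free and proper actions\<close>

lemma left_action_props:
  assumes "left_action G P m act" "\<gamma> \<in> arrow_set G" "p \<in> topspace P" "src G \<gamma> = m p"
  shows "act \<gamma> p \<in> topspace P" "m (act \<gamma> p) = rng G \<gamma>"
proof -
  have "(\<gamma>, p) \<in> topspace (left_fibre_product G P m)"
    using assms by (auto simp: left_fibre_product_def arrow_set_def)
  moreover have "(\<lambda>(\<gamma>, p). act \<gamma> p) \<in> topspace (left_fibre_product G P m) \<rightarrow> topspace P"
    using assms(1) by (intro continuous_map_funspace) (auto simp: left_action_def)
  ultimately show "act \<gamma> p \<in> topspace P" by (force simp: Pi_iff)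
  show "m (act \<gamma> p) = rng G \<gamma>"
    using assms by (auto simp: left_action_def)
qed

lemma right_action_props:
  assumes "right_action H P m act" "p \<in> topspace P" "\<eta> \<in> arrow_set H" "m p = rng H \<eta>"
  shows "act p \<eta> \<in> topspace P" "m (act p \<eta>) = src H \<eta>"
proof -
  have "(p, \<eta>) \<in> topspace (right_fibre_product P m H)"
    using assms by (auto simp: right_fibre_product_def arrow_set_def)
  moreover have "(\<lambda>(p, \<eta>). act p \<eta>) \<in> topspace (right_fibre_product P m H) \<rightarrow> topspace P"
    using assms(1) by (intro continuous_map_funspace) (auto simp: right_action_def)
  ultimately show "act p \<eta> \<in> topspace P" by (force simp: Pi_iff)
  show "m (act p \<eta>) = src H \<eta>"
    using assms by (auto simp: right_action_def)
qed

lemma continuous_map_right_action: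
  assumes "right_action H P m act" "continuous_map X P f" "continuous_map X (arrows H) g"
    and "\<And>x. x \<in> topspace X \<Longrightarrow> m (f x) = rng H (g x)"
  shows "continuous_map X P (\<lambda>x. act (f x) (g x))"
proof -
  have "continuous_map X (right_fibre_product P m H) (\<lambda>x. (f x, g x))"
    using assms by (auto simp: right_fibre_product_def continuous_map_in_subtopology continuous_map_paired)
  moreover have "continuous_map (right_fibre_product P m H) P (\<lambda>(p, \<eta>). act p \<eta>)"
    using assms(1) by (simp add: right_action_def)
  ultimately show ?thesis
    using continuous_map_compose by (fastforce simp: o_def)
qed

text \<open>The inverse of \<eta> times \<gamma> fixes \<open>p\<close>, so freeness makes it a
  unit. Then \<gamma> and \<eta> are both inverse to \<open>ginv G \<eta>\<close>, and inverses are
  unique.\<close>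

lemma left_free_cancel:
  assumes alg: "algebraic_groupoid G" and act: "left_action G P m act" and free: "left_free G P m act"
    and \<gamma>: "\<gamma> \<in> arrow_set G" and \<eta>: "\<eta> \<in> arrow_set G" and p: "p \<in> topspace P"
    and s: "src G \<gamma> = m p" "src G \<eta> = m p" and eq: "act \<gamma> p = act \<eta> p"
  shows "\<gamma> = \<eta>"
proof -
  note inv = ginv_props[OF alg]
  have r: "rng G \<gamma> = rng G \<eta>"
    using left_action_props(2)[OF act \<gamma> p s(1)] left_action_props(2)[OF act \<eta> p s(2)] eq by simp
  have assoc: "act \<alpha> (act \<beta> p) = act (mult G \<alpha> \<beta>) p"
    if "\<alpha> \<in> arrow_set G" "\<beta> \<in> arrow_set G" "src G \<alpha> = rng G \<beta>" "src G \<beta> = m p" for \<alpha> \<beta>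
    using act p that by (simp add: left_action_def)
  have "act (mult G (ginv G \<eta>) \<gamma>) p = act (ginv G \<eta>) (act \<gamma> p)"
    using \<gamma> \<eta> s r by (simp add: assoc inv)
  also have "\<dots> = act (mult G (ginv G \<eta>) \<eta>) p"
    unfolding eq using \<eta> s by (simp add: assoc inv)
  also have "\<dots> = p"
    using \<eta> s p act by (simp add: inv left_action_def)
  finally have "mult G (ginv G \<eta>) \<gamma> = m p"
    using free p \<gamma> \<eta> s r groupoid_mult_closed[OF alg inv(1)[OF \<eta>] \<gamma>] inv(3)[OF \<eta>]
    by (auto simp: left_free_def)
  then have "\<gamma> = ginv G (ginv G \<eta>)"
    using \<gamma> \<eta> s r by (intro ginv_unique[OF alg]) (auto simp: inv)
  moreover have "\<eta> = ginv G (ginv G \<eta>)"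
    using \<eta> by (intro ginv_unique[OF alg]) (auto simp: inv)
  ultimately show ?thesis by simp
qed

text \<open>
  Freeness and properness make \<open>(\<gamma>, p) \<mapsto> (\<gamma> \<cdot> p, p)\<close> a closed embedding; the arrow moving \<open>g x\<close>
  to \<open>f x\<close> is read off its inverse.
\<close>

lemma continuous_map_translation:
  assumes alg: "algebraic_groupoid G" and P: "lch_space P" and act: "left_action G P m act"
    and free: "left_free G P m act" and proper: "left_proper G P m act"
    and f: "continuous_map X P f" and g: "continuous_map X P g"
    and h: "\<And>x. x \<in> topspace X \<Longrightarrow> h x \<in> arrow_set G" "\<And>x. x \<in> topspace X \<Longrightarrow> src G (h x) = m (g x)"
      "\<And>x. x \<in> topspace X \<Longrightarrow> act (h x) (g x) = f x"
  shows "continuous_map X (arrows G) h"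
proof -
  let ?F = "left_fibre_product G P m" and ?\<Phi> = "\<lambda>(\<gamma>, p). (act \<gamma> p, p)"
  have "continuous_map ?F P snd"
    unfolding left_fibre_product_def by (rule continuous_map_from_subtopology) (rule continuous_map_snd)
  then have cont: "continuous_map ?F (prod_topology P P) ?\<Phi>"
    using act by (simp add: left_action_def case_prod_unfold continuous_map_paired)
  have "proper_map ?F (prod_topology P P) ?\<Phi>"
    using P proper cont by (intro compact_preimages_imp_proper_map lch_space_prod) (auto simp: left_proper_def)
  moreover have "inj_on ?\<Phi> (topspace ?F)"
    using left_free_cancel[OF alg act free]
    by (auto simp: inj_on_def left_fibre_product_def arrow_set_def)
  ultimately have "embedding_map ?F (prod_topology P P) ?\<Phi>"
    using cont by (intro injective_closed_imp_embedding_map) (auto simp: proper_map_def)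
  then obtain \<Psi> where \<Psi>: "homeomorphic_maps ?F (subtopology (prod_topology P P) (?\<Phi> ` topspace ?F)) ?\<Phi> \<Psi>"
    unfolding embedding_map_def homeomorphic_map_maps by blast
  have F: "(h x, g x) \<in> topspace ?F" "?\<Phi> (h x, g x) = (f x, g x)" if "x \<in> topspace X" for x
    using h[OF that] that g by (auto simp: left_fibre_product_def arrow_set_def continuous_map_def)
  have "(\<lambda>x. (f x, g x)) \<in> topspace X \<rightarrow> ?\<Phi> ` topspace ?F"
  proof (rule Pi_I)
    fix x assume "x \<in> topspace X"
    from F[OF this] show "(f x, g x) \<in> ?\<Phi> ` topspace ?F"
      by (intro image_eqI[where x = "(h x, g x)"]) simp_all
  qed
  then have "continuous_map X (subtopology (prod_topology P P) (?\<Phi> ` topspace ?F)) (\<lambda>x. (f x, g x))"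
    using f g by (simp add: continuous_map_in_subtopology continuous_map_paired)
  moreover have "continuous_map (subtopology (prod_topology P P) (?\<Phi> ` topspace ?F)) ?F \<Psi>"
    using \<Psi> by (simp add: homeomorphic_maps_def)
  moreover have "continuous_map ?F (arrows G) fst"
    unfolding left_fibre_product_def by (rule continuous_map_from_subtopology) (rule continuous_map_fst)
  ultimately have "continuous_map X (arrows G) (fst \<circ> (\<Psi> \<circ> (\<lambda>x. (f x, g x))))"
    by (intro continuous_map_compose)
  then show ?thesis
  proof (rule continuous_map_eq)
    fix x assume x: "x \<in> topspace X"
    have "\<Psi> (?\<Phi> (h x, g x)) = (h x, g x)"
      using \<Psi> F(1)[OF x] unfolding homeomorphic_maps_def by blast
    then show "(fst \<circ> (\<Psi> \<circ> (\<lambda>x. (f x, g x)))) x = h x"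
      using F(2)[OF x] by simp
  qed
qed

text \<open>Applied to the moment maps of an equivalence: the first part makes every unit a moment
  value, the second makes each action transitive on the fibres of the moment map of the
  other.\<close>

lemma induces_homeomorphism_props:
  assumes "induces_homeomorphism X q Y f"
  shows "f ` topspace X = topspace Y"
    and "x \<in> topspace X \<Longrightarrow> y \<in> topspace X \<Longrightarrow> f x = f y \<Longrightarrow> q x = q y"
proof -
  obtain h where h: "homeomorphic_map (quotient_space X q) Y h" "\<forall>x\<in>topspace X. h (q x) = f x"
    using assms by (auto simp: induces_homeomorphism_def)
  have "h ` (q ` topspace X) = topspace Y" "inj_on h (q ` topspace X)"
    using h(1) by (auto simp: homeomorphic_eq_everything_map topspace_quotient_space)
  moreover have "f ` topspace X = h ` (q ` topspace X)"
    unfolding image_image using h(2) by (intro image_cong) auto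
  ultimately show "f ` topspace X = topspace Y"
    and "x \<in> topspace X \<Longrightarrow> y \<in> topspace X \<Longrightarrow> f x = f y \<Longrightarrow> q x = q y"
    using h(2) by (simp, metis imageI inj_onD)
qed

text \<open>Serves to pass from the identification of the orbit space with
  \<open>unit_space E\<close> to one with the unit space of the quotient.\<close>

lemma induces_homeomorphism_compose:
  assumes "induces_homeomorphism X q Y f" "homeomorphic_map Y W g"
  shows "induces_homeomorphism X q W (\<lambda>x. g (f x))"
proof -
  obtain h where "homeomorphic_map (quotient_space X q) Y h" "\<forall>x\<in>topspace X. h (q x) = f x"
    using assms(1) by (auto simp: induces_homeomorphism_def)
  then show ?thesis
    using homeomorphic_map_compose[OF _ assms(2), of "quotient_space X q" h]
    unfolding induces_homeomorphism_def by (intro exI[of _ "g \<circ> h"]) auto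
qed

section \<open>Transport of a central circle along an equivalence\<close>

text \<open>The composite with \<open>j\<close> appears because \<open>central_circle\<close> is
  indexed by units of \<open>E\<close>, whereas \<iota> is indexed by units of
  \<open>G\<close>.\<close>

lemma twist_imp_central_circle:
  assumes "twist G E \<iota> j"
  shows "central_circle E (\<lambda>u t. \<iota> (j u, t))"
proof
  have lch: "lch_groupoid E" and hom: "groupoid_hom (trivial_circle_bundle G) E \<iota>"
    and emb: "embedding_map (arrows (trivial_circle_bundle G)) (arrows E) \<iota>"
    and homeo: "homeomorphic_map (unit_space E) (unit_space G) j"
    and one: "\<And>u. u \<in> units E \<Longrightarrow> \<iota> (j u, 1) = u"
    using assms by (auto simp: twist_def)
  let ?T = "trivial_circle_bundle G"
  have T: "arrows ?T = prod_topology (unit_space G) (top_of_set circle)"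
    by (simp add: trivial_circle_bundle_def)
  have j: "j u \<in> units G" if "u \<in> units E" for u
    using continuous_map_funspace[OF homeomorphic_imp_continuous_map[OF homeo]] that by auto
  have arr: "(j u, t) \<in> arrow_set ?T" if "u \<in> units E" "t \<in> circle" for u t
    using that j by (auto simp: arrow_set_def T)
  have mult: "src E (\<iota> (j u, s)) = rng E (\<iota> (j u, t))"
    "mult E (\<iota> (j u, s)) (\<iota> (j u, t)) = \<iota> (j u, s * t)"
    if "u \<in> units E" "s \<in> circle" "t \<in> circle" for u s t
    using groupoid_hom_mult[OF hom arr[OF that(1,2)] arr[OF that(1,3)]]
    by (simp_all add: trivial_circle_bundle_def)
  show "lch_groupoid E" by (rule lch)
  have "continuous_map (prod_topology (unit_space E) (top_of_set circle)) (arrows ?T) (\<lambda>(u, t). (j u, t))"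
    using homeomorphic_imp_continuous_map[OF homeo]
    by (simp add: T continuous_map_prod_top continuous_map_id[unfolded id_def])
  moreover have "continuous_map (arrows ?T) (arrows E) \<iota>"
    using emb continuous_map_into_fulltopology unfolding embedding_map_def homeomorphic_eq_everything_map by blast
  ultimately have "continuous_map (prod_topology (unit_space E) (top_of_set circle)) (arrows E) (\<iota> \<circ> (\<lambda>(u, t). (j u, t)))"
    by (rule continuous_map_compose)
  then
  show "continuous_map (prod_topology (unit_space E) (top_of_set circle)) (arrows E) (\<lambda>(u, t). \<iota> (j u, t))"
    by (simp add: o_def case_prod_unfold)
  fix u t
  { assume u: "u \<in> units E"
    show "\<iota> (j u, 1) = u" using u by (rule one)
    { assume t: "t \<in> circle"
      \<comment> \<open>A homomorphism is only required to preserve composability and products.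
        Range and source are found by composing with \<iota> at scalar 1, whose value is the unit
        \<open>u\<close>.\<close>
      show "rng E (\<iota> (j u, t)) = u" "src E (\<iota> (j u, t)) = u"
        using mult(1)[OF u, of 1 t] mult(1)[OF u t, of 1] one[OF u] unit_props[OF u] t by auto
      have "inj_on \<iota> (arrow_set ?T)"
        using emb by (auto simp: embedding_map_def homeomorphic_map_def arrow_set_def)
      moreover assume "\<iota> (j u, t) = u"
      ultimately show "t = 1"
        using one[OF u] inj_onD[of \<iota>, OF _ _ arr[OF u t] arr[OF u, of 1]] by simp } }
  show "mult E (\<iota> (j u, s)) (\<iota> (j u, t)) = \<iota> (j u, s * t)"
    if "u \<in> units E" "s \<in> circle" "t \<in> circle" for s
    using that by (rule mult(2))
  show "mult E (\<iota> (j (rng E e), t)) e = mult E e (\<iota> (j (src E e), t))"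
    if "e \<in> arrow_set E" "t \<in> circle" for e
    using assms that by (auto simp: twist_def)
qed

text \<open>Here \<open>F\<close> is the given twist \<open>E'\<close> and \<open>c u t\<close> its
  circle element over \<open>u\<close>. The aim is to show that \<open>E\<close> satisfies
  \<open>central_circle\<close> too.\<close>

locale central_circle_equivalence = F: central_circle F c
  for F :: "'f groupoid" and c :: "'f \<Rightarrow> complex \<Rightarrow> 'f" +
  fixes E :: "'e groupoid" and Z :: "('e, 'z, 'f) bispace"
  assumes lch_E: "lch_groupoid E" and equiv: "groupoid_equivalence E F Z"
begin

section \<open>Rules for the two commuting actions\<close>

abbreviation "P \<equiv> topspace (zspace Z)"
abbreviation "lm \<equiv> lmoment Z"
abbreviation "rm \<equiv> rmoment Z"

lemma alg_E: "algebraic_groupoid E"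
  using lch_E by (simp add: lch_groupoid_def topological_groupoid_def)

lemma left: "left_action E (zspace Z) lm (lact Z)" "left_free E (zspace Z) lm (lact Z)"
    "left_proper E (zspace Z) lm (lact Z)"
  and right: "right_action F (zspace Z) rm (ract Z)" "right_free F (zspace Z) rm (ract Z)"
  and lch_Z: "lch_space (zspace Z)"
  and commute: "commuting_actions E F Z"
  and lm_open: "open_map (zspace Z) (unit_space E) lm"
  and lm_homeo: "induces_homeomorphism (zspace Z) (right_orbit_map F Z) (unit_space E) lm"
  and rm_homeo: "induces_homeomorphism (zspace Z) (left_orbit_map E Z) (unit_space F) rm"
  using equiv by (auto simp: groupoid_equivalence_def)

lemma lm_image: "lm ` P = units E" and rm_image: "rm ` P = units F"
  using induces_homeomorphism_props(1)[OF lm_homeo] induces_homeomorphism_props(1)[OF rm_homeo] by auto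

lemma lm_units: "z \<in> P \<Longrightarrow> lm z \<in> units E" and rm_units: "z \<in> P \<Longrightarrow> rm z \<in> units F"
  using lm_image rm_image by auto

lemma lm_preimage:
  assumes "u \<in> units E"
  obtains z where "z \<in> P" "lm z = u"
  using assms lm_image by (metis imageE)

lemma lact_props:
  assumes "e \<in> arrow_set E" "z \<in> P" "src E e = lm z"
  shows "lact Z e z \<in> P" "lm (lact Z e z) = rng E e" "rm (lact Z e z) = rm z"
proof -
  \<comment> \<open>Commutation is stated for a pair of arrows; taking the unit \<open>rm z\<close>
    as the arrow of \<open>F\<close> yields invariance of \<open>rm\<close>.\<close>
  have "rm z \<in> arrow_set F" "rng F (rm z) = rm z"
    using rm_units assms unit_props by metis+
  then show "rm (lact Z e z) = rm z"
    using commute assms by (metis commuting_actions_def)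
qed (use left_action_props[OF left(1)] assms in auto)

lemma ract_props:
  assumes "z \<in> P" "f \<in> arrow_set F" "rm z = rng F f"
  shows "ract Z z f \<in> P" "rm (ract Z z f) = src F f" "lm (ract Z z f) = lm z"
proof -
  have "lm z \<in> arrow_set E" "src E (lm z) = lm z"
    using lm_units assms unit_props by metis+
  then show "lm (ract Z z f) = lm z"
    using commute assms by (metis commuting_actions_def)
qed (use right_action_props[OF right(1)] assms in auto)

lemma ract_lact:
  assumes "e \<in> arrow_set E" "z \<in> P" "f \<in> arrow_set F" "src E e = lm z" "rm z = rng F f"
  shows "ract Z (lact Z e z) f = lact Z e (ract Z z f)"
  using commute assms by (simp add: commuting_actions_def)

lemma lact_mult:
  assumes "x \<in> arrow_set E" "y \<in> arrow_set E" "z \<in> P" "src E x = rng E y" "src E y = lm z"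
  shows "lact Z (mult E x y) z = lact Z x (lact Z y z)"
  using left(1) assms by (simp add: left_action_def)

lemma lact_unit: "z \<in> P \<Longrightarrow> lact Z (lm z) z = z"
  using left(1) by (simp add: left_action_def)

lemma ract_mult:
  assumes "z \<in> P" "x \<in> arrow_set F" "y \<in> arrow_set F" "rm z = rng F x" "src F x = rng F y"
  shows "ract Z (ract Z z x) y = ract Z z (mult F x y)"
  using right(1) assms by (simp add: right_action_def)

lemma ract_unit: "z \<in> P \<Longrightarrow> ract Z z (rm z) = z"
  using right(1) by (simp add: right_action_def)

section \<open>The circle action on \<open>Z\<close>\<close>

text \<open>The right circle action coming from \<open>F\<close>, written with the scalar first. The
  order does not matter because the circle is commutative, as used in
  \<open>tau_tau\<close>.\<close>

definition tau :: "complex \<Rightarrow> 'z \<Rightarrow> 'z"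
  where "tau t z = ract Z z (c (rm z) t)"

lemma tau_props:
  assumes "z \<in> P" "t \<in> circle"
  shows "tau t z \<in> P" "rm (tau t z) = rm z" "lm (tau t z) = lm z"
  unfolding tau_def using assms rm_units[of z]
  by (simp_all add: ract_props F.k_closed F.k_rng F.k_src)

lemma tau_one: "z \<in> P \<Longrightarrow> tau 1 z = z"
  by (simp add: tau_def F.k_one rm_units ract_unit)

lemma tau_tau:
  assumes "z \<in> P" "s \<in> circle" "t \<in> circle"
  shows "tau s (tau t z) = tau (s * t) z"
proof -
  have "tau s (tau t z) = ract Z (ract Z z (c (rm z) t)) (c (rm z) s)"
    using tau_props[OF assms(1,3)] by (simp add: tau_def)
  also have "\<dots> = ract Z z (mult F (c (rm z) t) (c (rm z) s))"
    using assms rm_units[of z] by (intro ract_mult) (auto simp: F.k_closed F.k_rng F.k_src)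
  finally show ?thesis
    using assms rm_units[of z] by (simp add: F.k_mult tau_def mult.commute)
qed

lemma tau_free:
  assumes "z \<in> P" "t \<in> circle" "tau t z = z"
  shows "t = 1"
proof -
  have "c (rm z) t = rm z"
    using right(2) assms F.k_closed[of "rm z" t] F.k_rng[of "rm z" t] rm_units
    unfolding right_free_def tau_def by metis
  then show ?thesis
    using assms rm_units by (intro F.k_free) auto
qed

lemma tau_lact:
  assumes "e \<in> arrow_set E" "z \<in> P" "src E e = lm z" "t \<in> circle"
  shows "tau t (lact Z e z) = lact Z e (tau t z)"
  using assms rm_units[of z] by (simp add: tau_def lact_props ract_lact F.k_closed F.k_rng)

text \<open>Centrality in \<open>F\<close> exchanges the circle element at the source of
  \<open>f\<close> for the one at its range, which acts before \<open>f\<close>.\<close>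

lemma tau_ract:
  assumes "z \<in> P" "f \<in> arrow_set F" "rm z = rng F f" "t \<in> circle"
  shows "tau t (ract Z z f) = ract Z (tau t z) f"
proof -
  have u: "rng F f \<in> units F" "src F f \<in> units F" using assms by (auto simp: F.E_rules)
  have "tau t (ract Z z f) = ract Z z (mult F f (c (src F f) t))"
    using assms u by (simp add: tau_def ract_props ract_mult F.k_closed F.k_rng)
  also have "\<dots> = ract Z z (mult F (c (rm z) t) f)"
    using assms by (simp add: F.k_central)
  also have "\<dots> = ract Z (tau t z) f"
    using assms u by (simp add: tau_def ract_mult F.k_closed F.k_rng F.k_src)
  finally show ?thesis .
qed

lemma tau_continuous:
  "continuous_map (prod_topology (zspace Z) (top_of_set circle)) (zspace Z) (\<lambda>p. tau (snd p) (fst p))"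
proof -
  have "continuous_map (zspace Z) (unit_space F) rm"
    using right(1) by (simp add: right_action_def)
  from continuous_map_compose[OF continuous_map_fst[of "zspace Z" "top_of_set circle"] this]
  have "continuous_map (prod_topology (zspace Z) (top_of_set circle))
      (prod_topology (unit_space F) (top_of_set circle)) (\<lambda>p. (rm (fst p), snd p))"
    by (simp add: continuous_map_paired continuous_map_snd o_def)
  from continuous_map_compose[OF this F.k_continuous]
  show ?thesis
    unfolding tau_def using rm_units
    by (intro continuous_map_right_action[OF right(1)]) (auto simp: o_def continuous_map_fst F.k_rng)
qed

section \<open>Transport of the circle to \<open>E\<close>\<close>

lemma lact_cancel:
  assumes "x \<in> arrow_set E" "y \<in> arrow_set E" "z \<in> P" "src E x = lm z" "src E y = lm z"
    "lact Z x z = lact Z y z"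
  shows "x = y"
  using left_free_cancel[OF alg_E left(1,2)] assms by blast

lemma left_transitive:
  assumes "z \<in> P" "w \<in> P" "rm z = rm w"
  obtains e where "e \<in> arrow_set E" "src E e = lm w" "lact Z e w = z"
proof -
  have "left_orbit_map E Z z = left_orbit_map E Z w"
    using induces_homeomorphism_props(2)[OF rm_homeo] assms by blast
  moreover have "z \<in> left_orbit_map E Z z"
    using lm_units[of z] lact_unit[of z] assms unit_props[of "lm z" E]
    unfolding left_orbit_map_def left_orbit_def mem_Collect_eq by metis
  ultimately show ?thesis
    using that by (auto simp: left_orbit_map_def left_orbit_def)
qed

lemma right_transitive:
  assumes "z \<in> P" "w \<in> P" "lm z = lm w"
  obtains f where "f \<in> arrow_set F" "rm w = rng F f" "ract Z w f = z"
proof -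
  have "right_orbit_map F Z z = right_orbit_map F Z w"
    using induces_homeomorphism_props(2)[OF lm_homeo] assms by blast
  moreover have "z \<in> right_orbit_map F Z z"
    using rm_units[of z] ract_unit[of z] assms unit_props[of "rm z" F]
    unfolding right_orbit_map_def right_orbit_def mem_Collect_eq by metis
  ultimately show ?thesis
    using that by (auto simp: right_orbit_map_def right_orbit_def)
qed

text \<open>The required arrow must realise \<open>tau t\<close> on the whole fibre of
  \<open>lm\<close> over \<open>u\<close>, so independence of the chosen point is built into the
  specification. By freeness at most one arrow satisfies it.\<close>

definition transport :: "'e \<Rightarrow> complex \<Rightarrow> 'e"
  where "transport u t = (SOME e. e \<in> arrow_set E \<and> src E e = u \<and> (\<forall>z\<in>P. lm z = u \<longrightarrow> lact Z e z = tau t z))"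

text \<open>Since \<open>tau\<close> preserves \<open>rm\<close>, left transitivity gives an arrow
  \<open>e\<close> moving one point \<open>w\<close> of the fibre to \<open>tau t w\<close>. Any
  other point of the fibre is \<open>w\<close> acted on by some \<open>f\<close>, and both
  \<open>e\<close> and \<open>tau t\<close> commute with \<open>f\<close>.\<close>

lemma transport_spec:
  assumes u: "u \<in> units E" and t: "t \<in> circle"
  shows "transport u t \<in> arrow_set E" "src E (transport u t) = u" "\<And>z. z \<in> P \<Longrightarrow> lm z = u \<Longrightarrow> lact Z (transport u t) z = tau t z"
proof -
  obtain w where w: "w \<in> P" "lm w = u"
    using u by (rule lm_preimage)
  obtain e where e: "e \<in> arrow_set E" "src E e = lm w" "lact Z e w = tau t w"
    using left_transitive[of "tau t w" w] tau_props[OF w(1) t] w(1) by metis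
  have "lact Z e z = tau t z" if z: "z \<in> P" "lm z = u" for z
  proof -
    obtain f where f: "f \<in> arrow_set F" "rm w = rng F f" "ract Z w f = z"
      using right_transitive[of z w] w z by auto
    have "lact Z e z = ract Z (lact Z e w) f"
      using ract_lact[OF e(1) w(1) f(1) e(2) f(2)] f(3) by simp
    also have "\<dots> = tau t z"
      using tau_ract[OF w(1) f(1,2) t] e(3) f(3) by simp
    finally show ?thesis .
  qed
  then have "\<exists>e. e \<in> arrow_set E \<and> src E e = u \<and> (\<forall>z\<in>P. lm z = u \<longrightarrow> lact Z e z = tau t z)"
    using e w by auto
  from someI_ex[OF this]
  show "transport u t \<in> arrow_set E" "src E (transport u t) = u" "\<And>z. z \<in> P \<Longrightarrow> lm z = u \<Longrightarrow> lact Z (transport u t) z = tau t z"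
    unfolding transport_def[symmetric] by auto
qed

text \<open>Continuity is first proved upstairs, with \<open>lm z\<close> in place of
  \<open>u\<close>, where the arrow is the translation from \<open>z\<close> to
  \<open>tau t z\<close>; it then descends along \<open>lm\<close>.\<close>

lemma transport_continuous: "continuous_map (prod_topology (unit_space E) (top_of_set circle)) (arrows E) (\<lambda>(u, t). transport u t)"
proof -
  let ?ZT = "prod_topology (zspace Z) (top_of_set circle)"
  have "continuous_map ?ZT (arrows E) (\<lambda>p. transport (lm (fst p)) (snd p))"
    by (rule continuous_map_translation[OF alg_E lch_Z left tau_continuous continuous_map_fst])
      (auto simp: transport_spec lm_units)
  moreover have "quotient_map (zspace Z) (unit_space E) lm"
    using left(1) lm_open lm_image by (intro continuous_open_imp_quotient_map) (auto simp: left_action_def)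
  \<comment> \<open>The product of a quotient map with the identity of a locally compact Hausdorff
    space, here the circle, is again a quotient map.\<close>
  then have "quotient_map ?ZT (prod_topology (unit_space E) (top_of_set circle)) (\<lambda>(z, t). (lm z, t))"
    using compact_space_circle by (intro quotient_map_prod_left) (auto simp: compact_imp_locally_compact_space Hausdorff_space_subtopology)
  ultimately show ?thesis
    by - (erule continuous_compose_quotient_map, simp add: o_def case_prod_unfold)
qed

lemma transport_rng:
  assumes "u \<in> units E" "t \<in> circle"
  shows "rng E (transport u t) = u"
proof -
  obtain z where z: "z \<in> P" "lm z = u" using assms(1) by (rule lm_preimage)
  then show ?thesis
    using transport_spec[OF assms] lact_props(2)[of "transport u t" z] tau_props(3)[of z t] assms by auto
qed

text \<open>Each identity between arrows is tested on a point \<open>z\<close> of the fibre over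
  their common source: both sides move \<open>z\<close> to the same point, so
  \<open>lact_cancel\<close> makes them equal.\<close>

sublocale central_circle E transport
proof
  show "lch_groupoid E" by (rule lch_E)
  show "continuous_map (prod_topology (unit_space E) (top_of_set circle)) (arrows E) (\<lambda>(u, t). transport u t)"
    by (rule transport_continuous)
next
  fix u s t assume u: "u \<in> units E" and t: "t \<in> circle"
  obtain z where z: "z \<in> P" "lm z = u" using u by (rule lm_preimage)
  show "rng E (transport u t) = u" "src E (transport u t) = u"
    using transport_rng transport_spec u t by auto
  { assume "transport u t = u"
    then show "t = 1" using transport_spec(3)[OF u t z] lact_unit[OF z(1)] z tau_free[OF z(1) t] by simp }
  assume s: "s \<in> circle"
  have st: "s * t \<in> circle" using s t by (rule F.circle_mult)
  have "lact Z (mult E (transport u s) (transport u t)) z = tau s (tau t z)"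
    using u s t z by (simp add: lact_mult transport_spec transport_rng tau_props)
  also have "\<dots> = lact Z (transport u (s * t)) z"
    using transport_spec(3)[OF u st z] tau_tau[OF z(1) s t] by simp
  finally have eq: "lact Z (mult E (transport u s) (transport u t)) z = lact Z (transport u (s * t)) z" .
  have "src E (transport u s) = rng E (transport u t)"
    using transport_spec(2)[OF u s] transport_rng[OF u t] by simp
  from groupoid_mult_closed[OF alg_E transport_spec(1)[OF u s] transport_spec(1)[OF u t] this]
  show "mult E (transport u s) (transport u t) = transport u (s * t)"
    using transport_spec(1,2)[OF u st] transport_spec(2)[OF u t] z eq by (metis lact_cancel)
next
  fix u assume u: "u \<in> units E"
  obtain z where z: "z \<in> P" "lm z = u" using u by (rule lm_preimage)
  show "transport u 1 = u"
    using z transport_spec[OF u F.circle_one] lact_unit[OF z(1)] tau_one[OF z(1)] unit_props[OF u]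
    by (metis lact_cancel)
next
  fix e t assume e: "e \<in> arrow_set E" and t: "t \<in> circle"
  note u = rng_in_units[OF alg_E e] src_in_units[OF alg_E e]
  obtain z where z: "z \<in> P" "lm z = src E e" using u(2) by (rule lm_preimage)
  note ks = transport_spec[OF u(1) t] transport_rng[OF u(1) t] transport_spec[OF u(2) t] transport_rng[OF u(2) t]
  \<comment> \<open>The point \<open>lact Z e z\<close> lies over \<open>rng E e\<close>, so the
    transported element there acts on it as \<open>tau t\<close>. Centrality thus reflects that
    \<open>tau\<close> commutes with the \<open>E\<close>-action.\<close>
  have "lact Z (mult E (transport (rng E e) t) e) z = tau t (lact Z e z)"
    using e z lact_props[OF e z(1)] by (simp add: lact_mult ks)
  also have "\<dots> = lact Z (mult E e (transport (src E e) t)) z"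
    using e z t by (simp add: lact_mult ks tau_lact)
  finally have eq: "lact Z (mult E (transport (rng E e) t) e) z = lact Z (mult E e (transport (src E e) t)) z" .
  show "mult E (transport (rng E e) t) e = mult E e (transport (src E e) t)"
    using groupoid_mult_closed[OF alg_E ks(1) e ks(2)] groupoid_mult_closed[OF alg_E e ks(5)] ks(6,8) z eq
    by (metis lact_cancel)
qed

end

theorem theorem6p5:
  fixes G' :: "'h groupoid" and E' :: "'f groupoid"
    and \<iota>' :: "'h \<times> complex \<Rightarrow> 'f" and j' :: "'f \<Rightarrow> 'h"
    and E :: "'e groupoid" and Z :: "('e, 'z, 'f) bispace"
  assumes "lch_groupoid G'"
    and "twist G' E' \<iota>' j'"
    and "lch_groupoid E"
    and "groupoid_equivalence E E' Z"
  shows "\<exists>(a :: complex \<Rightarrow> 'e \<Rightarrow> 'e) (G :: 'e set groupoid) \<iota> j.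
    principal_circle_action (arrows E) a \<and>
    twist_via G E \<iota> j a \<and>
    induces_homeomorphism (zspace Z) (right_orbit_map E' Z) (unit_space G)
      (\<lambda>z. j (lmoment Z z)) \<and>
    twist_equivalence G E \<iota> j G' E' \<iota>' j' Z"
proof -
  interpret F: central_circle E' "\<lambda>u t. \<iota>' (j' u, t)"
    using assms(2) by (rule twist_imp_central_circle)
  interpret central_circle_equivalence E' "\<lambda>u t. \<iota>' (j' u, t)" E Z
    using assms(3,4) by unfold_locales
  \<comment> \<open>Compatibility of the two circle actions on \<open>Z\<close> is the defining
    property of \<open>transport\<close>.\<close>
  have "lact Z (incl (orb (lmoment Z z), t)) z = ract Z z (\<iota>' (j' (rmoment Z z), t))"
    if "t \<in> circle" "z \<in> topspace (zspace Z)" for t z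
    using that by (simp add: incl_orb lm_units transport_spec tau_def)
  then have "twist_equivalence Q E incl orb G' E' \<iota>' j' Z"
    using assms twist_Q by (simp add: twist_equivalence_def)
  \<comment> \<open>The witnesses are \<open>act\<close>, \<open>Q\<close>, \<open>incl\<close> and
    \<open>orb\<close> for the transported circle in \<open>E\<close>; the orbit space is identified
    with the units of \<open>Q\<close> by following \<open>lm\<close> with
    \<open>orb\<close>.\<close>
  then show ?thesis
    using principal_act twist_via_Q induces_homeomorphism_compose[OF lm_homeo orb_units_homeomorphism]
    by blast
qed

end
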